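(* In the graceful game, Bob has a winning strategy on every caterpillar with diameter at least three (no matter who starts).
   Context: A caterpillar $cat(k_1,\dots,k_s)$ is the tree obtained from a path $(v_1,\dots,v_s)$ (the spine) by attaching $k_j$ new leaf vertices to $v_j$ for each $j$. A graceful labeling of a graph $G$ with $m$ edges is an injective map $f\colon V(G)\to\{0,1,\dots,m\}$ such that the induced edge labels $|f(u)-f(v)|$, $uv\in E(G)$, are pairwise distinct. The graceful game on a simple graph $G$ with $m$ edges: two players, Alice and Bob, alternately choose a free (not yet labeled) vertex and assign to it a label from $\{0,1,\dots,m\}$ not yet used. An edge both of whose endpoints are labeled gets label $|f(u)-f(v)|$; a move is legal only if after it all edge labels are pairwise distinct. Alice wins if the whole graph ends up gracefully labeled; Bob wins if he can prevent this. Either player may be the first to move. *)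

theory Defs
  imports Main
begin

text \<open>A finite simple graph is given by its vertex set \<open>V\<close> and its edge set \<open>E\<close>,
  whose members are two-element subsets of \<open>V\<close>.\<close>

definition walk :: "'a set \<Rightarrow> 'a set set \<Rightarrow> 'a list \<Rightarrow> bool" where
  "walk V E xs \<longleftrightarrow>
     xs \<noteq> [] \<and> set xs \<subseteq> V \<and> (\<forall>i. Suc i < length xs \<longrightarrow> {xs ! i, xs ! Suc i} \<in> E)"

definition graph_dist :: "'a set \<Rightarrow> 'a set set \<Rightarrow> 'a \<Rightarrow> 'a \<Rightarrow> nat" where
  "graph_dist V E u v =
     (LEAST n. \<exists>xs. walk V E xs \<and> hd xs = u \<and> last xs = v \<and> length xs = Suc n)"

text \<open>Only meaningful for nonempty finite connected graphs.\<close>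

definition diameter :: "'a set \<Rightarrow> 'a set set \<Rightarrow> nat" where
  "diameter V E = Max {graph_dist V E u v | u v. u \<in> V \<and> v \<in> V}"

text \<open>\<open>is_cat ks V E\<close>: the graph is a copy of \<open>cat(ks)\<close>, with spine \<open>vs\<close> and
  \<open>L j\<close> the set of the \<open>ks ! j\<close> new leaves attached to \<open>vs ! j\<close> (indices start at 0).\<close>

definition is_cat :: "nat list \<Rightarrow> 'a set \<Rightarrow> 'a set set \<Rightarrow> bool" where
  "is_cat ks V E \<longleftrightarrow>
     (\<exists>(vs :: 'a list) (L :: nat \<Rightarrow> 'a set).
        length vs = length ks \<and> distinct vs \<and>
        (\<forall>j < length ks. finite (L j) \<and> card (L j) = ks ! j \<and> L j \<inter> set vs = {}) \<and>
        (\<forall>i < length ks. \<forall>j < length ks. i \<noteq> j \<longrightarrow> L i \<inter> L j = {}) \<and>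
        V = set vs \<union> (\<Union>j < length ks. L j) \<and>
        E = {{vs ! i, vs ! Suc i} | i. Suc i < length ks} \<union>
            {{vs ! j, x} | j x. j < length ks \<and> x \<in> L j})"

definition caterpillar :: "'a set \<Rightarrow> 'a set set \<Rightarrow> bool" where
  "caterpillar V E \<longleftrightarrow> (\<exists>ks. ks \<noteq> [] \<and> is_cat ks V E)"

text \<open>\<open>S\<close> is the set of vertices that are already labeled; only edges inside \<open>S\<close> carry a label.\<close>

definition distinct_edge_labels :: "'a set set \<Rightarrow> 'a set \<Rightarrow> ('a \<Rightarrow> nat) \<Rightarrow> bool" where
  "distinct_edge_labels E S f \<longleftrightarrow>
     (\<forall>u\<in>S. \<forall>v\<in>S. \<forall>x\<in>S. \<forall>y\<in>S.
        {u, v} \<in> E \<and> {x, y} \<in> E \<and> {u, v} \<noteq> {x, y} \<longrightarrow>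
        \<bar>int (f u) - int (f v)\<bar> \<noteq> \<bar>int (f x) - int (f y)\<bar>)"

definition graceful_labeling :: "'a set \<Rightarrow> 'a set set \<Rightarrow> ('a \<Rightarrow> nat) \<Rightarrow> bool" where
  "graceful_labeling V E f \<longleftrightarrow>
     inj_on f V \<and> f ` V \<subseteq> {0..card E} \<and> distinct_edge_labels E V f"

datatype player = Alice | Bob

fun opponent :: "player \<Rightarrow> player" where
  "opponent Alice = Bob"
| "opponent Bob = Alice"

text \<open>A move \<open>(v, l)\<close> assigns the label \<open>l\<close> to the vertex \<open>v\<close>. A history is the chronological
  list of the moves made so far, and a strategy maps histories to moves.\<close>

type_synonym 'a move = "'a \<times> nat"
type_synonym 'a history = "'a move list"
type_synonym 'a strategy = "'a history \<Rightarrow> 'a move"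

definition to_move :: "player \<Rightarrow> 'a history \<Rightarrow> player" where
  "to_move first h = (if even (length h) then first else opponent first)"

definition legal_move :: "'a set \<Rightarrow> 'a set set \<Rightarrow> 'a history \<Rightarrow> 'a move \<Rightarrow> bool" where
  "legal_move V E h mv \<longleftrightarrow>
     (case mv of (v, l) \<Rightarrow>
        v \<in> V \<and> v \<notin> fst ` set h \<and> l \<in> {0..card E} \<and> l \<notin> snd ` set h \<and>
        distinct_edge_labels E (insert v (fst ` set h)) (the \<circ> map_of (h @ [(v, l)])))"

inductive play :: "'a set \<Rightarrow> 'a set set \<Rightarrow> 'a history \<Rightarrow> bool" for V E where
  start: "play V E []"
| move: "play V E h \<Longrightarrow> legal_move V E h mv \<Longrightarrow> play V E (h @ [mv])"

definition finished :: "'a set \<Rightarrow> 'a set set \<Rightarrow> 'a history \<Rightarrow> bool" where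
  "finished V E h \<longleftrightarrow> play V E h \<and> (\<nexists>mv. legal_move V E h mv)"

definition gracefully_labeled :: "'a set \<Rightarrow> 'a set set \<Rightarrow> 'a history \<Rightarrow> bool" where
  "gracefully_labeled V E h \<longleftrightarrow>
     (\<exists>f. graceful_labeling V E f \<and> (\<forall>v\<in>V. map_of h v = Some (f v)))"

text \<open>In particular Bob wins a finished play in which no legal move is left although some
  vertex is unlabeled, whoever is to move.\<close>

fun wins :: "'a set \<Rightarrow> 'a set set \<Rightarrow> player \<Rightarrow> 'a history \<Rightarrow> bool" where
  "wins V E Alice h \<longleftrightarrow> gracefully_labeled V E h"
| "wins V E Bob h \<longleftrightarrow> \<not> gracefully_labeled V E h"

definition follows :: "player \<Rightarrow> player \<Rightarrow> 'a strategy \<Rightarrow> 'a history \<Rightarrow> bool" where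
  "follows first p \<sigma> h \<longleftrightarrow>
     (\<forall>i < length h. to_move first (take i h) = p \<longrightarrow> h ! i = \<sigma> (take i h))"

text \<open>The first conjunct excludes strategies that prescribe an illegal move although a legal one
  exists; for those the second conjunct could hold vacuously.\<close>

definition winning_strategy ::
    "'a set \<Rightarrow> 'a set set \<Rightarrow> player \<Rightarrow> player \<Rightarrow> 'a strategy \<Rightarrow> bool" where
  "winning_strategy V E first p \<sigma> \<longleftrightarrow>
     (\<forall>h. play V E h \<and> follows first p \<sigma> h \<longrightarrow>
        (to_move first h = p \<and> (\<exists>mv. legal_move V E h mv) \<longrightarrow> legal_move V E h (\<sigma> h)) \<and>
        (finished V E h \<longrightarrow> wins V E p h))"

end

theory Submission
  imports Defs
begin

text \<open>Let \<open>m\<close> be the number of edges. In a graceful labeling the edge label \<open>m\<close> joins the labels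
  \<open>0\<close> and \<open>m\<close>, and the edge label \<open>m - 1\<close> joins \<open>0, m - 1\<close> or \<open>1, m\<close>. So once a leaf has label
  \<open>0\<close>, its neighbour \<open>w\<close> must get \<open>m\<close> and some neighbour of \<open>w\<close> must get \<open>1\<close>. Bob labels a leaf
  with \<open>0\<close>; if Alice does not answer with \<open>m\<close> on \<open>w\<close>, he puts \<open>m\<close> on another vertex, and if she
  does, he puts \<open>1\<close> on a non-neighbour of \<open>w\<close>.

  If Alice has already labeled \<open>v\<close> with \<open>a\<close>, Bob's later moves may be illegal because of edges at
  \<open>v\<close>. Exchanging \<open>l\<close> with \<open>m - l\<close> removes the bad values of \<open>a\<close>, and a suitable choice of the leaf
  removes the bad positions, except when \<open>v\<close> is the far end of a star with one subdivided edge, or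
  a degree-two vertex next to the neighbour of a leaf, or an end of the path on five vertices.
  There a single move of Bob already rules out every graceful completion.\<close>

section \<open>Winning positions for Bob\<close>

text \<open>Quantifying over all graceful labelings rather than over continuations of the play makes
  this property stable under further moves and independent of which moves are legal.\<close>

definition dead :: "'a set \<Rightarrow> 'a set set \<Rightarrow> 'a history \<Rightarrow> bool" where
  "dead V E h \<longleftrightarrow> (\<forall>f. graceful_labeling V E f \<longrightarrow> (\<exists>(v, l) \<in> set h. f v \<noteq> l))"

text \<open>The unlabeled vertex in the rule \<open>alice\<close> excludes completed labelings, where Alice has
  no legal move and the last premise is vacuous.\<close>

inductive bob_wins :: "'a set \<Rightarrow> 'a set set \<Rightarrow> player \<Rightarrow> 'a history \<Rightarrow> bool" for V E first where
  dead: "dead V E h \<Longrightarrow> bob_wins V E first h"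
| bob: "to_move first h = Bob \<Longrightarrow> legal_move V E h mv \<Longrightarrow> bob_wins V E first (h @ [mv]) \<Longrightarrow>
    bob_wins V E first h"
| alice: "to_move first h = Alice \<Longrightarrow> x \<in> V \<Longrightarrow> x \<notin> fst ` set h \<Longrightarrow>
    (\<And>mv. legal_move V E h mv \<Longrightarrow> bob_wins V E first (h @ [mv])) \<Longrightarrow> bob_wins V E first h"

lemma dead_append: "dead V E h \<Longrightarrow> dead V E (h @ h')"
  unfolding dead_def by (simp add: bex_Un)

lemma gracefully_labeled_domain: "gracefully_labeled V E h \<Longrightarrow> v \<in> V \<Longrightarrow> v \<in> fst ` set h"
  unfolding gracefully_labeled_def by (metis domI dom_map_of_conv_image_fst)

lemma dead_not_gracefully_labeled:
  assumes "dead V E h" "fst ` set h \<subseteq> V" "distinct (map fst h)"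
  shows "\<not> gracefully_labeled V E h"
proof
  assume "gracefully_labeled V E h"
  then obtain f where f: "graceful_labeling V E f" "\<forall>v\<in>V. map_of h v = Some (f v)"
    unfolding gracefully_labeled_def by blast
  then obtain v l where "(v, l) \<in> set h" "f v \<noteq> l"
    using assms(1) unfolding dead_def by blast
  moreover from this have "v \<in> V" using assms(2) by force
  ultimately show False
    using f(2) assms(3) by (metis map_of_eq_Some_iff option.inject)
qed

lemma play_domain:
  assumes "play V E h"
  shows "fst ` set h \<subseteq> V \<and> distinct (map fst h)"
  using assms by induction (auto simp: legal_move_def split: prod.splits)

text \<open>A case distinction on the last rule suffices: \<open>bob\<close> and
  \<open>alice\<close> both exhibit an unlabeled vertex, and \<open>dead\<close> excludes a graceful
  completion.\<close>

lemma bob_wins_not_gracefully_labeled: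
  assumes "bob_wins V E first h" "play V E h"
  shows "\<not> gracefully_labeled V E h"
  using assms
proof cases
  case dead
  then show ?thesis using play_domain[OF assms(2)] dead_not_gracefully_labeled by blast
next
  case (bob mv)
  then have "fst mv \<in> V" "fst mv \<notin> fst ` set h"
    unfolding legal_move_def by (auto split: prod.splits)
  then show ?thesis using gracefully_labeled_domain[of V E h "fst mv"] by blast
next
  case (alice x)
  then show ?thesis using gracefully_labeled_domain[of V E h x] by blast
qed

text \<open>\<open>bob_wins\<close> is an invariant that Bob can maintain and Alice cannot leave, so
  every play following the chosen strategy ends in such a position.\<close>

lemma bob_wins_imp_strategy:
  assumes "bob_wins V E first []"
  shows "\<exists>\<sigma>. winning_strategy V E first Bob \<sigma>"
proof -
  define good where "good h mv \<longleftrightarrow> legal_move V E h mv \<and> bob_wins V E first (h @ [mv])" for h mv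
  \<comment> \<open>By \<open>good_\<sigma>\<close> the first branch applies whenever Bob is to move
    in a position with \<open>bob_wins\<close> and some legal move; the second covers the remaining
    histories.\<close>
  define \<sigma> where "\<sigma> h = (if \<exists>mv. good h mv then SOME mv. good h mv else SOME mv. legal_move V E h mv)" for h
  have good_\<sigma>: "good h (\<sigma> h)"
    if "bob_wins V E first h" "to_move first h = Bob" "legal_move V E h mv" for h mv
  proof -
    from that(1) have "\<exists>mv. good h mv"
    proof cases
      \<comment> \<open>A dead position stays dead, so any legal move is good.\<close>
      case dead
      then show ?thesis using that(3) dead_append bob_wins.dead unfolding good_def by blast
    next
      case (bob mv)
      then show ?thesis unfolding good_def by blast
    next
      case alice
      then show ?thesis using that(2) by simp
    qed
    then show ?thesis unfolding \<sigma>_def by (simp add: someI_ex)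
  qed
  have wins: "follows first Bob \<sigma> h \<Longrightarrow> bob_wins V E first h" if "play V E h" for h
    using that
  proof induction
    case start
    show ?case by (rule assms)
  next
    case (move h mv)
    have step: "to_move first (take i (h @ [mv])) = Bob \<Longrightarrow> (h @ [mv]) ! i = \<sigma> (take i (h @ [mv]))"
      if "i < Suc (length h)" for i
      using move.prems that unfolding follows_def by simp
    have fh: "follows first Bob \<sigma> h"
      unfolding follows_def
    proof (intro allI impI)
      fix i assume "i < length h" "to_move first (take i h) = Bob"
      then show "h ! i = \<sigma> (take i h)" using step[of i] by (simp add: nth_append)
    qed
    have mv: "to_move first h = Bob \<Longrightarrow> mv = \<sigma> h"
      using step[of "length h"] by simp
    have bw: "bob_wins V E first h" using move.IH fh by blast
    show ?case
    proof (cases "to_move first h")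
      case Alice
      from bw show ?thesis
      proof cases
        case dead
        then show ?thesis by (simp add: dead_append bob_wins.dead)
      next
        case bob
        then show ?thesis using Alice by simp
      next
        case alice
        show ?thesis by (rule alice(4)) (rule move.hyps)
      qed
    next
      case Bob
      then show ?thesis using good_\<sigma>[OF bw Bob move.hyps(2)] mv[OF Bob] unfolding good_def by simp
    qed
  qed
  have "winning_strategy V E first Bob \<sigma>"
    unfolding winning_strategy_def
  proof (intro allI impI conjI; elim conjE)
    fix h assume h: "play V E h" "follows first Bob \<sigma> h"
    show "legal_move V E h (\<sigma> h)" if "to_move first h = Bob" "\<exists>mv. legal_move V E h mv"
      using good_\<sigma>[OF wins[OF h] that(1)] that(2) unfolding good_def by blast
    show "wins V E Bob h"
      using bob_wins_not_gracefully_labeled[OF wins[OF h] h(1)] by simp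
  qed
  then show ?thesis by blast
qed

section \<open>Complementary labels\<close>

definition compl_move :: "'a set set \<Rightarrow> 'a move \<Rightarrow> 'a move" where
  "compl_move E mv = (fst mv, card E - snd mv)"

text \<open>Reflection keeps absolute differences. Stating it over \<open>int\<close> avoids
  truncated subtraction.\<close>

lemma distinct_edge_labels_reflect:
  assumes d: "distinct_edge_labels E S f" and g: "\<And>x. x \<in> S \<Longrightarrow> int (g x) = c - int (f x)"
  shows "distinct_edge_labels E S g"
  unfolding distinct_edge_labels_def
proof (intro ballI impI)
  fix u w x y assume S: "u \<in> S" "w \<in> S" "x \<in> S" "y \<in> S"
    and e: "{u, w} \<in> E \<and> {x, y} \<in> E \<and> {u, w} \<noteq> {x, y}"
  have "\<bar>int (f u) - int (f w)\<bar> \<noteq> \<bar>int (f x) - int (f y)\<bar>"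
    using d S e unfolding distinct_edge_labels_def by blast
  then show "\<bar>int (g u) - int (g w)\<bar> \<noteq> \<bar>int (g x) - int (g y)\<bar>"
    unfolding g[OF S(1)] g[OF S(2)] g[OF S(3)] g[OF S(4)] by (simp add: abs_minus_commute)
qed

lemma graceful_labeling_compl:
  assumes "graceful_labeling V E f"
  shows "graceful_labeling V E (\<lambda>v. card E - f v)"
proof -
  have le: "f v \<le> card E" if "v \<in> V" for v
    using assms that unfolding graceful_labeling_def by auto
  have "inj_on (\<lambda>v. card E - f v) V"
    using assms le unfolding graceful_labeling_def inj_on_def
    by (metis diff_diff_cancel)
  moreover have "distinct_edge_labels E V (\<lambda>v. card E - f v)"
  proof (rule distinct_edge_labels_reflect)
    show "distinct_edge_labels E V f" using assms unfolding graceful_labeling_def by blast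
    show "int (card E - f x) = int (card E) - int (f x)" if "x \<in> V" for x
      using le[OF that] by (rule of_nat_diff)
  qed
  ultimately show ?thesis unfolding graceful_labeling_def by auto
qed

lemma map_of_compl: "map_of (map (compl_move E) h) v = map_option (\<lambda>l. card E - l) (map_of h v)"
  by (induction h) (auto simp: compl_move_def)

lemma compl_move_compl_move: "snd mv \<le> card E \<Longrightarrow> compl_move E (compl_move E mv) = mv"
  by (auto simp: compl_move_def prod_eq_iff)

lemma fst_compl: "fst ` compl_move E ` A = fst ` A"
  by (force simp: compl_move_def image_image)

lemma legal_move_compl:
  assumes "legal_move V E h mv" "\<forall>mv\<in>set h. snd mv \<le> card E"
  shows "legal_move V E (map (compl_move E) h) (compl_move E mv)"
proof -
  obtain v l where mv: "mv = (v, l)" by force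
  let ?f = "the \<circ> map_of (h @ [(v, l)])"
  let ?g = "the \<circ> map_of (map (compl_move E) h @ [(v, card E - l)])"
  let ?S = "insert v (fst ` set h)"
  have l: "l \<le> card E" "v \<in> V" "v \<notin> fst ` set h" "l \<notin> snd ` set h"
    and d: "distinct_edge_labels E ?S ?f"
    using assms(1) unfolding legal_move_def mv by auto
  have fg: "int (?g x) = int (card E) - int (?f x)" if x: "x \<in> ?S" for x
  proof -
    have "map (compl_move E) h @ [(v, card E - l)] = map (compl_move E) (h @ [(v, l)])"
      by (simp add: compl_move_def)
    moreover obtain k where k: "map_of (h @ [(v, l)]) x = Some k"
      using x map_of_eq_None_iff[of "h @ [(v, l)]" x] by fastforce
    moreover have "k \<le> card E"
      using map_of_SomeD[OF k] l(1) assms(2) by auto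
    ultimately show ?thesis by (simp only: map_of_compl comp_def) (simp add: of_nat_diff)
  qed
  have "distinct_edge_labels E ?S ?g"
    by (rule distinct_edge_labels_reflect[OF d fg])
  moreover have "card E - l \<notin> snd ` set (map (compl_move E) h)"
  proof
    assume "card E - l \<in> snd ` set (map (compl_move E) h)"
    then obtain k where "k \<in> set h" "card E - snd k = card E - l"
      by (auto simp: compl_move_def)
    then have "snd k = l" using l(1) assms(2) by (metis diff_diff_cancel)
    then show False using \<open>k \<in> set h\<close> l(4) by blast
  qed
  ultimately show ?thesis
    using l unfolding legal_move_def mv compl_move_def
    by (auto simp: image_image compl_move_def)
qed

lemma dead_compl:
  assumes "dead V E h" "\<forall>mv\<in>set h. fst mv \<in> V \<and> snd mv \<le> card E"
  shows "dead V E (map (compl_move E) h)"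
  unfolding dead_def
proof (intro allI impI)
  fix f assume f: "graceful_labeling V E f"
  obtain v l where vl: "(v, l) \<in> set h" "card E - f v \<noteq> l"
    using assms(1) graceful_labeling_compl[OF f] unfolding dead_def by blast
  have "v \<in> V" "l \<le> card E" using assms(2) vl by force+
  then have "f v \<noteq> card E - l"
    using vl f unfolding graceful_labeling_def by auto
  then show "\<exists>(v, l)\<in>set (map (compl_move E) h). f v \<noteq> l"
    using vl by (force simp: compl_move_def)
qed

text \<open>Complementation is an involution on moves with labels up to \<open>card E\<close>, so
  Alice's replies in the complemented position are the complements of legal replies in the original
  one. Later a label \<open>a\<close> of Alice may therefore be exchanged for
  \<open>card E - a\<close>.\<close>

lemma bob_wins_compl:
  assumes "bob_wins V E first h" "\<forall>mv\<in>set h. fst mv \<in> V \<and> snd mv \<le> card E"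
  shows "bob_wins V E first (map (compl_move E) h)"
  using assms
proof induction
  case (dead h)
  then show ?case by (simp add: dead_compl bob_wins.dead)
next
  case (bob h mv)
  have "fst mv \<in> V \<and> snd mv \<le> card E"
    using bob.hyps(2) unfolding legal_move_def by auto
  then show ?case
    using bob legal_move_compl[OF bob.hyps(2)] bob_wins.bob[of first _ V E "compl_move E mv"]
    by (simp add: to_move_def)
next
  case (alice h x)
  show ?case
  proof (rule bob_wins.alice)
    show "to_move first (map (compl_move E) h) = Alice"
      using alice.hyps by (simp add: to_move_def)
    show "x \<in> V" "x \<notin> fst ` set (map (compl_move E) h)"
      using alice.hyps by (auto simp: fst_compl)
    fix mv assume mv: "legal_move V E (map (compl_move E) h) mv"
    have s: "fst mv \<in> V \<and> snd mv \<le> card E"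
      using mv unfolding legal_move_def by auto
    have hh: "map (compl_move E) (map (compl_move E) h) = h"
      using alice.prems by (simp add: compl_move_compl_move map_idI)
    have "legal_move V E h (compl_move E mv)"
      using legal_move_compl[OF mv] hh by (simp add: compl_move_def)
    then have "bob_wins V E first (map (compl_move E) (h @ [compl_move E mv]))"
      using alice.IH alice.prems s by (simp add: compl_move_def[of E mv])
    then show "bob_wins V E first (map (compl_move E) h @ [mv])"
      using s by (simp add: compl_move_compl_move)
  qed
qed

lemma bob_wins_compl_single:
  assumes "bob_wins V E first [(v, card E - a)]" "v \<in> V" "a \<le> card E"
  shows "bob_wins V E first [(v, a)]"
  using bob_wins_compl[OF assms(1)] assms(2,3) by (simp add: compl_move_def)

section \<open>Legality of a single move\<close>

text \<open>Only edges at \<open>z\<close> gain a label. Pairs of old edges are covered by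
  \<open>d\<close>, a new against an old edge by \<open>1\<close>, and two new edges by
  \<open>2\<close>.\<close>

lemma legal_moveI:
  fixes h :: "'a history"
  defines "f \<equiv> (the \<circ> map_of h)"
  assumes "z \<in> V" "z \<notin> fst ` set h" "l \<le> card E" "l \<notin> snd ` set h" "{z, z} \<notin> E"
    and d: "distinct_edge_labels E (fst ` set h) f"
    and 1: "\<And>u x y. u \<in> fst ` set h \<Longrightarrow> x \<in> fst ` set h \<Longrightarrow> y \<in> fst ` set h \<Longrightarrow>
      {z, u} \<in> E \<Longrightarrow> {x, y} \<in> E \<Longrightarrow> \<bar>int l - int (f u)\<bar> \<noteq> \<bar>int (f x) - int (f y)\<bar>"
    and 2: "\<And>u x. u \<in> fst ` set h \<Longrightarrow> x \<in> fst ` set h \<Longrightarrow> u \<noteq> x \<Longrightarrow>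
      {z, u} \<in> E \<Longrightarrow> {z, x} \<in> E \<Longrightarrow> \<bar>int l - int (f u)\<bar> \<noteq> \<bar>int l - int (f x)\<bar>"
  shows "legal_move V E h (z, l)"
proof -
  let ?g = "the \<circ> map_of (h @ [(z, l)])"
  have g: "?g x = f x" if "x \<in> fst ` set h" for x
  proof -
    obtain k where "map_of h x = Some k"
      using \<open>x \<in> fst ` set h\<close> by (cases "map_of h x") (auto simp: map_of_eq_None_iff)
    then show ?thesis by (simp add: f_def map_add_def)
  qed
  have gz: "?g z = l"
    using assms(3) by (simp add: map_add_def map_of_eq_None_iff[THEN iffD2])
  let ?S = "fst ` set h"
  have "distinct_edge_labels E (insert z ?S) ?g"
    unfolding distinct_edge_labels_def
  proof (intro ballI impI, elim conjE)
    fix u w x y assume S: "u \<in> insert z ?S" "w \<in> insert z ?S" "x \<in> insert z ?S" "y \<in> insert z ?S"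
      and e: "{u, w} \<in> E" "{x, y} \<in> E" "{u, w} \<noteq> {x, y}"
    \<comment> \<open>There is no loop at \<open>z\<close>, so every labeled edge has an old end.
      Writing that end second leaves four cases, according to whether the first ends are
      \<open>z\<close>.\<close>
    have norm: "\<exists>a b. a \<in> insert z ?S \<and> b \<in> ?S \<and> {u, w} = {a, b} \<and>
        \<bar>int (?g u) - int (?g w)\<bar> = \<bar>int (?g a) - int (f b)\<bar>"
      if uw: "u \<in> insert z ?S" "w \<in> insert z ?S" "{u, w} \<in> E" for u w
    proof (cases "w = z")
      case True
      then have "u \<in> ?S" using uw \<open>{z, z} \<notin> E\<close> by blast
      then show ?thesis using True g[of u]
        by (intro exI[of _ z] exI[of _ u]) (simp only: insert_commute abs_minus_commute, simp)
    next
      case False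
      then show ?thesis using uw g[of w] by (intro exI[of _ u] exI[of _ w]) simp
    qed
    obtain a b where ab: "a \<in> insert z ?S" "b \<in> ?S" "{u, w} = {a, b}"
        "\<bar>int (?g u) - int (?g w)\<bar> = \<bar>int (?g a) - int (f b)\<bar>"
      using norm[OF S(1,2) e(1)] by blast
    obtain c k where ck: "c \<in> insert z ?S" "k \<in> ?S" "{x, y} = {c, k}"
        "\<bar>int (?g x) - int (?g y)\<bar> = \<bar>int (?g c) - int (f k)\<bar>"
      using norm[OF S(3,4) e(2)] by blast
    have E: "{a, b} \<in> E" "{c, k} \<in> E" "{a, b} \<noteq> {c, k}" using e ab(3) ck(3) by simp_all
    have "\<bar>int (?g a) - int (f b)\<bar> \<noteq> \<bar>int (?g c) - int (f k)\<bar>"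
    proof (cases "a = z"; cases "c = z")
      assume z: "a = z" "c = z"
      then have "b \<noteq> k" using E(3) by blast
      then show ?thesis using 2[OF ab(2) ck(2)] E(1,2) unfolding z gz by blast
    next
      assume z: "a = z" "c \<noteq> z"
      then have c: "c \<in> ?S" using ck(1) by blast
      show ?thesis using 1[OF ab(2) c ck(2)] E(1,2) unfolding z(1) gz g[OF c] by blast
    next
      assume z: "a \<noteq> z" "c = z"
      then have a: "a \<in> ?S" using ab(1) by blast
      show ?thesis using 1[OF ck(2) a ab(2)] E(1,2) unfolding z(2) gz g[OF a] by metis
    next
      assume "a \<noteq> z" "c \<noteq> z"
      then have S: "a \<in> ?S" "c \<in> ?S" using ab(1) ck(1) by blast+
      show ?thesis using d S ab(2) ck(2) E unfolding g[OF S(1)] g[OF S(2)] distinct_edge_labels_def by blast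
    qed
    then show "\<bar>int (?g u) - int (?g w)\<bar> \<noteq> \<bar>int (?g x) - int (?g y)\<bar>"
      unfolding ab(4) ck(4) .
  qed
  then show ?thesis using assms(2-5) unfolding legal_move_def by simp
qed

section \<open>Labels around a leaf\<close>

locale finite_graph =
  fixes V :: "'a set" and E :: "'a set set"
  assumes finite_E: "finite E"
    and edge_doubleton: "e \<in> E \<Longrightarrow> \<exists>x y. x \<in> V \<and> y \<in> V \<and> x \<noteq> y \<and> e = {x, y}"
begin

abbreviation adj :: "'a \<Rightarrow> 'a \<Rightarrow> bool" where
  "adj x y \<equiv> {x, y} \<in> E"

definition pendant :: "'a \<Rightarrow> 'a \<Rightarrow> bool" where
  "pendant l w \<longleftrightarrow> adj l w \<and> (\<forall>x. adj l x \<longrightarrow> x = w)"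

lemma adj_irrefl [simp]: "\<not> adj x x"
  using edge_doubleton[of "{x, x}"] by (auto simp: doubleton_eq_iff)

lemma adj_singleton [simp]: "{x} \<notin> E"
  using adj_irrefl[of x] by simp

lemma adj_sym: "adj x y \<Longrightarrow> adj y x"
  by (simp add: insert_commute)

lemma adj_in_V: "adj x y \<Longrightarrow> x \<in> V \<and> y \<in> V"
  using edge_doubleton[of "{x, y}"] by (auto simp: doubleton_eq_iff)

section \<open>Edge labels forced in a graceful labeling\<close>

text \<open>Counting: the \<open>card E\<close> distinct edge labels are nonzero by injectivity, so
  they lie in \<open>{1..card E}\<close> and exhaust it.\<close>

lemma graceful_edge_label:
  assumes g: "graceful_labeling V E f" and k: "1 \<le> k" "k \<le> card E"
  shows "\<exists>x y. adj x y \<and> f x = f y + k"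
proof -
  have inj: "inj_on f V" and ran: "f ` V \<subseteq> {0..card E}" and d: "distinct_edge_labels E V f"
    using g unfolding graceful_labeling_def by auto
  \<comment> \<open>\<open>Max\<close> minus \<open>Min\<close> makes the label a function of the
    edge as a set, as the counting needs.\<close>
  define lab where "lab e = Max (f ` e) - Min (f ` e)" for e
  have lab: "int (lab {x, y}) = \<bar>int (f x) - int (f y)\<bar>" for x y
    unfolding lab_def by (auto simp: max_def min_def)
  have "inj_on lab E"
  proof
    fix e e' assume e: "e \<in> E" "e' \<in> E" "lab e = lab e'"
    obtain u w where u: "u \<in> V" "w \<in> V" "e = {u, w}" using edge_doubleton[OF e(1)] by blast
    obtain x y where x: "x \<in> V" "y \<in> V" "e' = {x, y}" using edge_doubleton[OF e(2)] by blast
    have "\<bar>int (f u) - int (f w)\<bar> = \<bar>int (f x) - int (f y)\<bar>"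
      using e(3) lab[of u w] lab[of x y] unfolding u(3) x(3) by simp
    then show "e = e'"
      using d e(1,2) u x unfolding distinct_edge_labels_def by blast
  qed
  moreover have "lab ` E \<subseteq> {1..card E}"
  proof
    fix n assume "n \<in> lab ` E"
    then obtain x y where xy: "x \<in> V" "y \<in> V" "x \<noteq> y" "n = lab {x, y}"
      using edge_doubleton by blast
    have "f x \<noteq> f y" "f x \<le> card E" "f y \<le> card E"
      using xy(1-3) inj_onD[OF inj, of x y] ran by (blast, auto)
    then show "n \<in> {1..card E}" using lab[of x y] xy(4) by auto
  qed
  ultimately have "lab ` E = {1..card E}"
    by (intro card_subset_eq) (auto simp: card_image)
  then have "k \<in> lab ` E" using k by simp
  then obtain e where e: "e \<in> E" "lab e = k" by blast
  obtain x y where "e = {x, y}" using edge_doubleton[OF e(1)] by blast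
  then have "adj x y" "lab {x, y} = k" using e by auto
  then have "\<bar>int (f x) - int (f y)\<bar> = int k" using lab[of x y] by simp
  then have "f x = f y + k \<or> f y = f x + k" by linarith
  then show ?thesis using \<open>adj x y\<close> adj_sym by blast
qed

lemma graceful_inj: "graceful_labeling V E f \<Longrightarrow> x \<in> V \<Longrightarrow> y \<in> V \<Longrightarrow> f x = f y \<Longrightarrow> x = y"
  unfolding graceful_labeling_def inj_on_def by blast

lemma graceful_le: "graceful_labeling V E f \<Longrightarrow> x \<in> V \<Longrightarrow> f x \<le> card E"
  unfolding graceful_labeling_def by auto

text \<open>Two labels differ by \<open>card E\<close> only if they are \<open>0\<close> and
  \<open>card E\<close>, and \<open>0\<close> sits on \<open>u\<close> alone.\<close>

lemma graceful_zero_adj_top: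
  assumes g: "graceful_labeling V E f" and "u \<in> V" "f u = 0" "1 \<le> card E"
  shows "\<exists>x. adj u x \<and> f x = card E"
proof -
  obtain x y where xy: "adj x y" "f x = f y + card E"
    using graceful_edge_label[OF g, of "card E"] assms by auto
  have "f x \<le> card E" using graceful_le[OF g] adj_in_V[OF xy(1)] by blast
  then have "f y = 0" "f x = card E" using xy by auto
  moreover from this have "y = u" using graceful_inj[OF g] adj_in_V[OF xy(1)] assms by metis
  ultimately show ?thesis using xy adj_sym by blast
qed

lemma graceful_pendant_zero:
  assumes "graceful_labeling V E f" "pendant l w" "f l = 0" "1 \<le> card E"
  shows "f w = card E"
  using graceful_zero_adj_top[OF assms(1), of l] assms adj_in_V unfolding pendant_def by blast

lemma graceful_pendant_one:
  assumes g: "graceful_labeling V E f" and p: "pendant l w" and 0: "f l = 0" and m: "2 \<le> card E"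
  shows "\<exists>x. adj w x \<and> f x = 1"
proof -
  obtain x y where xy: "adj x y" "f x = f y + (card E - 1)"
    using graceful_edge_label[OF g, of "card E - 1"] m by (metis diff_le_self le_diff_conv2
        add_leD1 one_add_one)
  have V: "x \<in> V" "y \<in> V" "l \<in> V" "w \<in> V" using adj_in_V xy p unfolding pendant_def by blast+
  have w: "f w = card E" using graceful_pendant_zero[OF g p 0] m by simp
  have "f x \<le> card E" using graceful_le[OF g] V by blast
  then consider "f y = 0" "f x = card E - 1" | "f y = 1" "f x = card E" using xy m by linarith
  then show ?thesis
  proof cases
    \<comment> \<open>Label \<open>0\<close> sits on \<open>l\<close> alone, and the only edge at
      \<open>l\<close> leads to \<open>w\<close>, whose label is \<open>card E\<close> and not
      \<open>card E - 1\<close>.\<close>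
    case 1
    then have "y = l" using graceful_inj[OF g] V 0 by metis
    then have "x = w" using xy(1) adj_sym p unfolding pendant_def by blast
    then show ?thesis using 1 w m by simp
  next
    case 2
    then have "x = w" using graceful_inj[OF g] V w by metis
    then show ?thesis using 2 xy(1) by blast
  qed
qed

lemma deadI:
  assumes "\<And>f. graceful_labeling V E f \<Longrightarrow> (\<And>v l. (v, l) \<in> set h \<Longrightarrow> f v = l) \<Longrightarrow> False"
  shows "dead V E h"
  unfolding dead_def using assms by blast

text \<open>The last premise unites the two ways of violating \<open>f w = card E\<close>: a
  different label on \<open>w\<close>, or \<open>card E\<close> on a different vertex.\<close>

lemma dead_pendant_zero:
  assumes "pendant l w" "1 \<le> card E" "(l, 0) \<in> set h" "(x, k) \<in> set h" "x \<in> V"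
    "x = w \<longleftrightarrow> k \<noteq> card E"
  shows "dead V E h"
proof (rule deadI)
  fix f assume g: "graceful_labeling V E f" and "\<And>v l. (v, l) \<in> set h \<Longrightarrow> f v = l"
  then have "f l = 0" "f x = k" using assms by auto
  moreover have "f w = card E"
    using graceful_pendant_zero[OF g assms(1)] \<open>f l = 0\<close> assms(2) by blast
  moreover have "w \<in> V" using assms(1) adj_in_V unfolding pendant_def by blast
  ultimately show False using graceful_inj[OF g, of x w] assms(5,6) by metis
qed

lemma dead_pendant_one:
  assumes "pendant l w" "2 \<le> card E" "(l, 0) \<in> set h" "(z, 1) \<in> set h" "z \<in> V" "\<not> adj w z"
  shows "dead V E h"
proof (rule deadI)
  fix f assume g: "graceful_labeling V E f" and "\<And>v l. (v, l) \<in> set h \<Longrightarrow> f v = l"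
  then have "f l = 0" "f z = 1" using assms by auto
  obtain x where x: "adj w x" "f x = 1"
    using graceful_pendant_one[OF g assms(1) \<open>f l = 0\<close> assms(2)] by blast
  then have "x = z"
    using graceful_inj[OF g, of x z] adj_in_V[OF x(1)] assms(5) \<open>f z = 1\<close> by simp
  then show False using x assms(6) by simp
qed

section \<open>Bob's play when he starts\<close>

text \<open>\<open>z\<close> is the vertex that receives \<open>1\<close> after Alice has labeled
  \<open>w\<close>; \<open>fourth\<close> supplies the vertex that receives \<open>card E\<close>
  after she has labeled some other \<open>y\<close>.\<close>

lemma bob_first_wins:
  assumes p: "pendant l w" and z: "z \<in> V" "z \<noteq> l" "z \<noteq> w" "\<not> adj w z"
    and fourth: "\<And>y. \<exists>z \<in> V - {l, w, y}. True" and m: "3 \<le> card E"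
  shows "bob_wins V E Bob []"
proof (rule bob_wins.bob[where mv = "(l, 0)"])
  have lw: "l \<in> V" "w \<in> V" "l \<noteq> w" "adj l w" "adj w l"
    using p adj_in_V[of l w] unfolding pendant_def by (auto simp: insert_commute)
  have l_adj: "adj x l \<longleftrightarrow> x = w" "adj l x \<longleftrightarrow> x = w" for x
    using p adj_sym unfolding pendant_def by blast+
  show "to_move Bob [] = Bob" by (simp add: to_move_def)
  show "legal_move V E [] (l, 0)"
    by (rule legal_moveI) (use lw in \<open>auto simp: distinct_edge_labels_def\<close>)
  show "bob_wins V E Bob ([] @ [(l, 0)])"
  proof (rule bob_wins.alice)
    show "to_move Bob ([] @ [(l, 0)]) = Alice" by (simp add: to_move_def)
    show "w \<in> V" "w \<notin> fst ` set ([] @ [(l, 0)])" using lw by auto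
    fix mv :: "'a move" assume L: "legal_move V E ([] @ [(l, 0)]) mv"
    obtain y b where mv: "mv = (y, b)" by force
    have y: "y \<in> V" "y \<noteq> l" "b \<le> card E" "b \<noteq> 0"
      and d: "distinct_edge_labels E {l, y} (the \<circ> map_of [(l, 0), (y, b)])"
      using L unfolding mv legal_move_def by (auto simp: insert_commute)
    let ?h = "[(l, 0), (y, b)]"
    have "bob_wins V E Bob ?h"
    \<comment> \<open>Alice escapes an immediate loss only with \<open>card E\<close> on
      \<open>w\<close> or with another label elsewhere.\<close>
    proof (cases "y = w \<longleftrightarrow> b \<noteq> card E")
      case True
      show ?thesis
        by (rule bob_wins.dead, rule dead_pendant_zero[OF p, of _ y b]) (use True y m in auto)
    next
      case False
      show ?thesis
      proof (cases "y = w")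
        case True
        show ?thesis
        proof (rule bob_wins.bob[where mv = "(z, 1)"])
          show "to_move Bob ?h = Bob" by (simp add: to_move_def)
          show "legal_move V E ?h (z, 1)"
          proof (rule legal_moveI)
            show "distinct_edge_labels E (fst ` set ?h) (the \<circ> map_of ?h)"
              using d by simp
            \<comment> \<open>The labeled vertices are \<open>l\<close> and \<open>w\<close>, and
              \<open>z\<close> is adjacent to neither, so no edge gains a label.\<close>
            fix u assume "u \<in> fst ` set ?h" "{z, u} \<in> E"
            then have False using z adj_sym[of z w] True by (auto simp: l_adj)
            then show "\<And>x y. \<bar>int 1 - int ((the \<circ> map_of ?h) u)\<bar> \<noteq>
                  \<bar>int ((the \<circ> map_of ?h) x) - int ((the \<circ> map_of ?h) y)\<bar>"
              "\<And>x. \<bar>int 1 - int ((the \<circ> map_of ?h) u)\<bar> \<noteq>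
                  \<bar>int 1 - int ((the \<circ> map_of ?h) x)\<bar>" by blast+
          qed (use z m y True False in auto)
          show "bob_wins V E Bob (?h @ [(z, 1)])"
            by (rule bob_wins.dead, rule dead_pendant_one[OF p, of _ z]) (use z m in auto)
        qed
      next
        case yw: False
        obtain x where x: "x \<in> V" "x \<noteq> l" "x \<noteq> w" "x \<noteq> y" using fourth by blast
        show ?thesis
        proof (rule bob_wins.bob[where mv = "(x, card E)"])
          show "to_move Bob ?h = Bob" by (simp add: to_move_def)
          show "legal_move V E ?h (x, card E)"
          proof (rule legal_moveI)
            show "distinct_edge_labels E (fst ` set ?h) (the \<circ> map_of ?h)"
              using d by simp
            \<comment> \<open>The only neighbour \<open>w\<close> of \<open>l\<close> is unlabeled,
              so no edge has a label yet and at most the edge from \<open>x\<close> to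
              \<open>y\<close> gains one.\<close>
            fix u assume "u \<in> fst ` set ?h" "{x, u} \<in> E"
            then have u: "u = y" using x by (auto simp: l_adj)
            {
              fix t t' assume "t \<in> fst ` set ?h" "t' \<in> fst ` set ?h" "{t, t'} \<in> E"
              then have False using yw lw(3) by (auto simp: l_adj)
              then show "\<bar>int (card E) - int ((the \<circ> map_of ?h) u)\<bar> \<noteq>
                  \<bar>int ((the \<circ> map_of ?h) t) - int ((the \<circ> map_of ?h) t')\<bar>" ..
            }
            fix t assume "t \<in> fst ` set ?h" "{x, t} \<in> E" "u \<noteq> t"
            then have False using u x by (auto simp: l_adj)
            then show "\<bar>int (card E) - int ((the \<circ> map_of ?h) u)\<bar> \<noteq>
                  \<bar>int (card E) - int ((the \<circ> map_of ?h) t)\<bar>" ..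
          qed (use x m y yw False in auto)
          show "bob_wins V E Bob (?h @ [(x, card E)])"
            by (rule bob_wins.dead, rule dead_pendant_zero[OF p, of _ x "card E"]) (use x m in auto)
        qed
      qed
    qed
    then show "bob_wins V E Bob (([] @ [(l, 0)]) @ [mv])" by (simp add: mv)
  qed
qed

section \<open>Bob's replies to Alice's first move\<close>

lemma legal_second_move:
  assumes "z \<in> V" "z \<noteq> v" "l \<le> card E" "l \<noteq> a"
  shows "legal_move V E [(v, a)] (z, l)"
  by (rule legal_moveI) (use assms in \<open>auto simp: distinct_edge_labels_def\<close>)

lemma bob_wins_second_move:
  assumes "z \<in> V" "z \<noteq> v" "l \<le> card E" "l \<noteq> a" "bob_wins V E Alice [(v, a), (z, l)]"
  shows "bob_wins V E Alice [(v, a)]"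
  by (rule bob_wins.bob[OF _ legal_second_move[OF assms(1-4)]])
    (use assms(5) in \<open>simp_all add: to_move_def\<close>)

text \<open>With \<open>0\<close> on \<open>v\<close>, the label \<open>card E\<close> has to appear
  on a neighbour of \<open>v\<close>. Bob puts it on the non-neighbour \<open>x\<close>; the case
  \<open>a = card E\<close> follows by complementation.\<close>

lemma bob_wins_extreme_label:
  assumes "v \<in> V" "x \<in> V" "x \<noteq> v" "\<not> adj v x" "1 \<le> card E" "a = 0 \<or> a = card E"
  shows "bob_wins V E Alice [(v, a)]"
proof -
  have 0: "bob_wins V E Alice [(v, 0)]"
  proof (rule bob_wins_second_move[of x v "card E"])
    show "bob_wins V E Alice [(v, 0), (x, card E)]"
    proof (rule bob_wins.dead, rule deadI)
      fix f assume g: "graceful_labeling V E f"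
        and f: "\<And>u l. (u, l) \<in> set [(v, 0), (x, card E)] \<Longrightarrow> f u = l"
      then have "f v = 0" "f x = card E" by auto
      obtain y where y: "adj v y" "f y = card E"
        using graceful_zero_adj_top[OF g assms(1) \<open>f v = 0\<close> assms(5)] by blast
      then have "y = x"
        using graceful_inj[OF g, of y x] adj_in_V[OF y(1)] assms(2) \<open>f x = card E\<close> by simp
      then show False using y assms(4) by simp
    qed
  qed (use assms in auto)
  then show ?thesis using assms bob_wins_compl_single[of V E Alice v a] by auto
qed

text \<open>Label \<open>0\<close> on \<open>l\<close> demands \<open>card E\<close> on
  \<open>v\<close>, which already carries \<open>a\<close>.\<close>

lemma bob_wins_pendant_neighbour:
  assumes p: "pendant l v" and "1 \<le> card E" "a \<noteq> 0" "a \<noteq> card E"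
  shows "bob_wins V E Alice [(v, a)]"
proof (rule bob_wins_second_move[of l v 0])
  have V: "l \<in> V" "v \<in> V" "l \<noteq> v" using p adj_in_V[of l v] unfolding pendant_def by auto
  then show "l \<in> V" "l \<noteq> v" by auto
  show "bob_wins V E Alice [(v, a), (l, 0)]"
    by (rule bob_wins.dead, rule dead_pendant_zero[OF p, of _ v a]) (use V assms in auto)
qed (use assms in auto)

text \<open>\<open>z\<close> and \<open>fifth\<close> provide the vertices for \<open>1\<close> and
  \<open>card E\<close> as in the game that Bob starts. If \<open>v\<close> and \<open>y\<close> are
  adjacent, their edge has a label already, and \<open>fifth\<close> keeps Bob's vertex away from
  both. The condition \<open>a \<noteq> 1\<close> leaves \<open>1\<close> available for
  \<open>z\<close>.\<close>

lemma bob_wins_far_pendant_aux: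
  assumes p: "pendant l w" and v: "v \<in> V" "v \<noteq> l" "v \<noteq> w"
    and z: "z \<in> V" "z \<noteq> l" "z \<noteq> w" "z \<noteq> v" "\<not> adj w z"
    and fifth: "\<And>y. y \<in> V \<Longrightarrow> y \<notin> {v, l, w} \<Longrightarrow>
      \<exists>x \<in> V - {v, l, w, y}. adj v y \<longrightarrow> \<not> adj x v \<and> \<not> adj x y"
    and m: "4 \<le> card E" and a: "a \<noteq> 0" "a < card E" "a \<noteq> 1" "2 * a \<noteq> card E + 1"
  shows "bob_wins V E Alice [(v, a)]"
proof (rule bob_wins_second_move[of l v 0])
  have lw: "l \<in> V" "w \<in> V" "l \<noteq> w" "adj l w" "adj w l"
    using p adj_in_V[of l w] unfolding pendant_def by (auto simp: insert_commute)
  have l_adj: "adj x l \<longleftrightarrow> x = w" "adj l x \<longleftrightarrow> x = w" for x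
    using p adj_sym unfolding pendant_def by blast+
  show "l \<in> V" "l \<noteq> v" "0 \<le> card E" "0 \<noteq> a" using lw v a by auto
  show "bob_wins V E Alice [(v, a), (l, 0)]"
  proof (rule bob_wins.alice)
    show "to_move Alice [(v, a), (l, 0)] = Alice" by (simp add: to_move_def)
    show "w \<in> V" "w \<notin> fst ` set [(v, a), (l, 0)]" using lw v by auto
    fix mv :: "'a move" assume L: "legal_move V E [(v, a), (l, 0)] mv"
    obtain y b where mv: "mv = (y, b)" by force
    have y: "y \<in> V" "y \<noteq> v" "y \<noteq> l" "b \<le> card E" "b \<noteq> 0" "b \<noteq> a"
      and d: "distinct_edge_labels E {v, l, y} (the \<circ> map_of [(v, a), (l, 0), (y, b)])"
      using L unfolding mv legal_move_def by (auto simp: insert_commute)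
    let ?h = "[(v, a), (l, 0), (y, b)]"
    have "bob_wins V E Alice ?h"
    proof (cases "y = w \<longleftrightarrow> b \<noteq> card E")
      case True
      show ?thesis
        by (rule bob_wins.dead, rule dead_pendant_zero[OF p, of _ y b]) (use True y m in auto)
    next
      case False
      show ?thesis
      proof (cases "y = w")
        case True
        show ?thesis
        proof (rule bob_wins.bob[where mv = "(z, 1)"])
          show "to_move Alice ?h = Bob" by (simp add: to_move_def)
          show "legal_move V E ?h (z, 1)"
          proof (rule legal_moveI)
            show "distinct_edge_labels E (fst ` set ?h) (the \<circ> map_of ?h)"
              using d by simp
            have b: "b = card E" using True False by simp
            have zadj: "\<not> adj z w" "\<not> adj z l" using z l_adj adj_sym by blast+
            fix u assume u: "u \<in> fst ` set ?h" "{z, u} \<in> E"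
            then have uv: "u = v" using zadj True by auto
            {
              fix x x' assume x: "x \<in> fst ` set ?h" "x' \<in> fst ` set ?h" "{x, x'} \<in> E"
              \<comment> \<open>The labeled edges are \<open>{l, w}\<close> with label
                \<open>card E\<close> and possibly \<open>{v, w}\<close> with label
                \<open>card E - a\<close>. A new edge from \<open>z\<close> to \<open>v\<close> has
                label \<open>a - 1\<close>, which could only clash if
                \<open>2 * a = card E + 1\<close>.\<close>
              then have "{x, x'} = {l, w} \<or> {x, x'} = {v, w}" using v True by (auto simp: l_adj insert_commute)
              then show "\<bar>int 1 - int ((the \<circ> map_of ?h) u)\<bar> \<noteq>
                  \<bar>int ((the \<circ> map_of ?h) x) - int ((the \<circ> map_of ?h) x')\<bar>"
                using uv True v lw b a m by (auto simp: doubleton_eq_iff)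
            }
            fix x assume "x \<in> fst ` set ?h" "{z, x} \<in> E" "u \<noteq> x"
            then show "\<bar>int 1 - int ((the \<circ> map_of ?h) u)\<bar> \<noteq>
                  \<bar>int 1 - int ((the \<circ> map_of ?h) x)\<bar>"
              using uv zadj True by auto
          qed (use z m a y True False in auto)
          show "bob_wins V E Alice (?h @ [(z, 1)])"
            by (rule bob_wins.dead, rule dead_pendant_one[OF p, of _ z]) (use z m in auto)
        qed
      next
        case yw: False
        obtain x where x: "x \<in> V" "x \<noteq> l" "x \<noteq> w" "x \<noteq> y" "x \<noteq> v"
            and xadj: "adj v y \<Longrightarrow> \<not> adj x v \<and> \<not> adj x y"
          using fifth[of y] y yw by blast
        have b: "b < card E" using yw False y by simp
        show ?thesis
        proof (rule bob_wins.bob[where mv = "(x, card E)"])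
          show "to_move Alice ?h = Bob" by (simp add: to_move_def)
          show "legal_move V E ?h (x, card E)"
          proof (rule legal_moveI)
            show "distinct_edge_labels E (fst ` set ?h) (the \<circ> map_of ?h)"
              using d by simp
            fix u assume u: "u \<in> fst ` set ?h" "{x, u} \<in> E"
            then have uv: "u = v \<or> u = y" using x by (auto simp: l_adj)
            {
              fix t t' assume t: "t \<in> fst ` set ?h" "t' \<in> fst ` set ?h" "{t, t'} \<in> E"
              then have "adj v y" using v yw adj_sym[of y v] by (auto simp: l_adj)
              then have False using uv u xadj by auto
              then show "\<bar>int (card E) - int ((the \<circ> map_of ?h) u)\<bar> \<noteq>
                  \<bar>int ((the \<circ> map_of ?h) t) - int ((the \<circ> map_of ?h) t')\<bar>" ..
            }
            \<comment> \<open>The two new edges have labels \<open>card E - a\<close> and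
              \<open>card E - b\<close>, and \<open>a\<close> and \<open>b\<close> differ.\<close>
            fix t assume "t \<in> fst ` set ?h" "{x, t} \<in> E" "u \<noteq> t"
            then have "{u, t} = {v, y}" using uv x by (auto simp: l_adj)
            then show "\<bar>int (card E) - int ((the \<circ> map_of ?h) u)\<bar> \<noteq>
                  \<bar>int (card E) - int ((the \<circ> map_of ?h) t)\<bar>"
              using v y a b by (auto simp: doubleton_eq_iff)
          qed (use x a b m in auto)
          show "bob_wins V E Alice (?h @ [(x, card E)])"
            by (rule bob_wins.dead, rule dead_pendant_zero[OF p, of _ x "card E"]) (use x m in auto)
        qed
      qed
    qed
    then show "bob_wins V E Alice ([(v, a), (l, 0)] @ [mv])" by (simp add: mv)
  qed
qed

text \<open>If \<open>a = 1\<close> or \<open>2 * a = card E + 1\<close>, then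
  \<open>card E - a\<close> avoids both equations because \<open>card E\<close> is at least four, so
  the complemented position is covered by the previous result.\<close>

lemma bob_wins_far_pendant:
  assumes p: "pendant l w" and v: "v \<in> V" "v \<noteq> l" "v \<noteq> w"
    and z: "z \<in> V" "z \<noteq> l" "z \<noteq> w" "z \<noteq> v" "\<not> adj w z"
    and t: "t \<in> V" "t \<notin> {v, l, w, z}"
    and adj: "\<And>y. adj v y \<Longrightarrow> y \<noteq> w \<Longrightarrow> \<exists>x \<in> V - {v, l, w, y}. \<not> adj x v \<and> \<not> adj x y"
    and m: "4 \<le> card E" and a: "a \<noteq> 0" "a < card E"
  shows "bob_wins V E Alice [(v, a)]"
proof -
  have fifth: "\<exists>x \<in> V - {v, l, w, y}. adj v y \<longrightarrow> \<not> adj x v \<and> \<not> adj x y" if "y \<notin> {v, l, w}" for y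
  proof (cases "adj v y")
    case True
    then show ?thesis using adj[of y] that by blast
  next
    \<comment> \<open>Without an edge from \<open>v\<close> to \<open>y\<close> any fifth vertex
      serves: \<open>z\<close>, or \<open>t\<close> if \<open>y = z\<close>.\<close>
    case False
    then show ?thesis using t z by (cases "y = z") blast+
  qed
  show ?thesis
  proof (cases "a \<noteq> 1 \<and> 2 * a \<noteq> card E + 1")
    case True
    show ?thesis
      by (rule bob_wins_far_pendant_aux[OF p v z fifth m a]) (use True in auto)
  next
    case False
    have "bob_wins V E Alice [(v, card E - a)]"
      by (rule bob_wins_far_pendant_aux[OF p v z fifth m]) (use False m a in \<open>assumption | linarith\<close>)+
    then show ?thesis using bob_wins_compl_single[of V E Alice v a] a v by simp
  qed
qed

text \<open>With \<open>0\<close> on \<open>l\<close>, the label of \<open>w\<close> is \<open>m\<close>; edges at \<open>w\<close> avoid the edge label \<open>m - a\<close>,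
  so it has to occur on \<open>v q\<close>, which forces \<open>2 a - m\<close> on \<open>q\<close>.\<close>

lemma bob_wins_broom:
  assumes p: "pendant l w" and v: "v \<in> V" "v \<noteq> l" "v \<noteq> w" "\<not> adj w v" and q: "adj v q" "q \<noteq> l"
    and rest: "\<And>x y. adj x y \<Longrightarrow> x = w \<or> y = w \<or> {x, y} = {v, q}"
    and m: "2 \<le> card E" and a: "a \<noteq> 0" "a < card E"
  shows "bob_wins V E Alice [(v, a)]"
proof -
  have lw: "l \<in> V" "w \<in> V" "q \<in> V" "l \<noteq> w" "adj l w" "q \<noteq> w"
    using p q(1) v(4) adj_in_V[of l w] adj_in_V[of v q] adj_sym[of v q] unfolding pendant_def by auto
  \<comment> \<open>Under \<open>2 * a \<le> card E\<close> the forced label of \<open>q\<close> is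
    at most \<open>0\<close>, while \<open>0\<close> is taken by \<open>l\<close>; the other
    orientation of the edge would give \<open>q\<close> the label \<open>card E\<close> of
    \<open>w\<close>. Larger \<open>a\<close> are complemented.\<close>
  have main: "bob_wins V E Alice [(v, a)]" if a: "a \<noteq> 0" "a < card E" "2 * a \<le> card E" for a
  proof (rule bob_wins_second_move[of l v 0])
    show "bob_wins V E Alice [(v, a), (l, 0)]"
    proof (rule bob_wins.dead, rule deadI)
      fix f assume g: "graceful_labeling V E f"
        and "\<And>u k. (u, k) \<in> set [(v, a), (l, 0)] \<Longrightarrow> f u = k"
      then have f: "f v = a" "f l = 0" by auto
      then have fw: "f w = card E" using graceful_pendant_zero[OF g p] m by auto
      obtain x y where xy: "adj x y" "f x = f y + (card E - a)"
        using graceful_edge_label[OF g _ diff_le_self, of a] a(2) by force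
      have V: "x \<in> V" "y \<in> V" using adj_in_V[OF xy(1)] by auto
      have le: "f x \<le> card E" "f q \<le> card E" using graceful_le[OF g] V lw by auto
      have "f q \<noteq> 0" "f q \<noteq> card E"
        using graceful_inj[OF g, of q l] graceful_inj[OF g, of q w] lw q f fw by auto
      moreover have "x \<noteq> w"
      proof
        assume "x = w"
        then have "f y = a" using xy fw a by simp
        then have "y = v" using graceful_inj[OF g, of y v] V v f by simp
        then show False using \<open>x = w\<close> xy v by simp
      qed
      moreover have "y \<noteq> w" using xy le a fw by auto
      ultimately have "{x, y} = {v, q}" using rest xy by blast
      then show False using xy f a \<open>f q \<noteq> 0\<close> \<open>f q \<noteq> card E\<close> le
        by (auto simp: doubleton_eq_iff)
    qed
  qed (use lw v a in auto)
  show ?thesis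
  proof (cases "2 * a \<le> card E")
    case True
    then show ?thesis using main a by blast
  next
    case False
    then have "bob_wins V E Alice [(v, card E - a)]" using main[of "card E - a"] a by simp
    then show ?thesis using bob_wins_compl_single[of V E Alice v a] a v by simp
  qed
qed

text \<open>With \<open>0\<close> on \<open>l\<close>, some neighbour of \<open>w\<close> must carry
  \<open>1\<close>, and only \<open>v\<close> is left for it. This refutes every \<open>a\<close>
  other than \<open>1\<close>; the complement of \<open>1\<close> is again different from
  \<open>1\<close>.\<close>

lemma bob_wins_pendant_degree_two:
  assumes p: "pendant l w" and v: "v \<in> V" "v \<noteq> l" and w: "\<And>x. adj w x \<Longrightarrow> x = l \<or> x = v"
    and m: "3 \<le> card E" and a: "a \<noteq> 0" "a < card E"
  shows "bob_wins V E Alice [(v, a)]"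
proof -
  have lw: "l \<in> V" using p adj_in_V unfolding pendant_def by blast
  have main: "bob_wins V E Alice [(v, a)]" if a: "a \<noteq> 0" "a \<noteq> 1" for a
  proof (rule bob_wins_second_move[of l v 0])
    show "bob_wins V E Alice [(v, a), (l, 0)]"
    proof (rule bob_wins.dead, rule deadI)
      fix f assume g: "graceful_labeling V E f"
        and "\<And>u k. (u, k) \<in> set [(v, a), (l, 0)] \<Longrightarrow> f u = k"
      then have "f v = a" "f l = 0" by auto
      then show False using graceful_pendant_one[OF g p] w a m by fastforce
    qed
  qed (use lw v a in auto)
  show ?thesis
  proof (cases "a = 1")
    case False
    then show ?thesis using main a by blast
  next
    case True
    then have "bob_wins V E Alice [(v, card E - a)]" using main[of "card E - a"] m by simp
    then show ?thesis using bob_wins_compl_single[of V E Alice v a] a v by simp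
  qed
qed

text \<open>Bob puts \<open>0\<close> next to \<open>v\<close>, not on a leaf. Then
  \<open>q2\<close> must carry \<open>4\<close>, so for \<open>a = 1\<close> or \<open>a = 2\<close>
  the path reads \<open>a, 0, 4\<close> followed by the two remaining labels, and both orders repeat
  an edge label. The value \<open>3\<close> is the complement of \<open>1\<close>.\<close>

lemma bob_wins_end_of_path5:
  assumes E: "E = {{v, q1}, {q1, q2}, {q2, q3}, {q3, q4}}" and d: "distinct [v, q1, q2, q3, q4]"
    and a: "a \<noteq> 0" "a < card E"
  shows "bob_wins V E Alice [(v, a)]"
proof -
  have m: "card E = 4" using d unfolding E by (simp add: doubleton_eq_iff)
  have V: "v \<in> V" "q1 \<in> V" "q2 \<in> V" "q3 \<in> V" "q4 \<in> V"
    using adj_in_V[of v q1] adj_in_V[of q2 q3] adj_in_V[of q3 q4] E by auto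
  have main: "bob_wins V E Alice [(v, a)]" if a: "a = 1 \<or> a = 2" for a
  proof (rule bob_wins_second_move[of q1 v 0])
    show "bob_wins V E Alice [(v, a), (q1, 0)]"
    proof (rule bob_wins.dead, rule deadI)
      fix f assume g: "graceful_labeling V E f"
        and "\<And>u k. (u, k) \<in> set [(v, a), (q1, 0)] \<Longrightarrow> f u = k"
      then have f: "f v = a" "f q1 = 0" by auto
      have "f q2 = 4"
        using graceful_zero_adj_top[OF g V(2) f(2)] m f a d unfolding E by (auto simp: doubleton_eq_iff)
      have le: "f x \<le> 4" if "x \<in> V" for x using graceful_le[OF g that] m by simp
      have neq: "f x \<noteq> f y" if "x \<in> V" "y \<in> V" "x \<noteq> y" for x y
        using graceful_inj[OF g] that by blast
      have n: "f q3 \<noteq> 0" "f q3 \<noteq> 4" "f q3 \<noteq> a" "f q4 \<noteq> 0" "f q4 \<noteq> 4" "f q4 \<noteq> a"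
          "f q3 \<noteq> f q4" "f q3 \<le> 4" "f q4 \<le> 4"
        using neq[of q3 q1] neq[of q3 q2] neq[of q3 v] neq[of q4 q1] neq[of q4 q2] neq[of q4 v]
          neq[of q3 q4] le V d f \<open>f q2 = 4\<close> by auto
      have dl: "\<bar>int (f u) - int (f w)\<bar> \<noteq> \<bar>int (f x) - int (f y)\<bar>"
        if "adj u w" "adj x y" "{u, w} \<noteq> {x, y}" for u w x y
        using g adj_in_V[OF that(1)] adj_in_V[OF that(2)] that
        unfolding graceful_labeling_def distinct_edge_labels_def by blast
      have l1: "int a \<noteq> 4 - int (f q3)"
        using dl[of v q1 q2 q3] d f \<open>f q2 = 4\<close> n unfolding E by (simp add: doubleton_eq_iff)
      have l2: "int a \<noteq> \<bar>int (f q3) - int (f q4)\<bar>"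
        using dl[of v q1 q3 q4] d f unfolding E by (simp add: doubleton_eq_iff)
      have l3: "4 - int (f q3) \<noteq> \<bar>int (f q3) - int (f q4)\<bar>"
        using dl[of q2 q3 q3 q4] d \<open>f q2 = 4\<close> n unfolding E by (simp add: doubleton_eq_iff)
      have "f q3 = 1 \<or> f q3 = 2 \<or> f q3 = 3" "f q4 = 1 \<or> f q4 = 2 \<or> f q4 = 3"
        using n(1,2,4,5,8,9) by auto
      then show False using a by (elim disjE) (use n l1 l2 l3 in simp_all)
    qed
  qed (use V d a in auto)
  show ?thesis
  proof (cases "a = 3")
    case False
    show ?thesis by (rule main) (use False a m in linarith)
  next
    case True
    then have "bob_wins V E Alice [(v, card E - a)]" using main[of "card E - a"] m by simp
    then show ?thesis using bob_wins_compl_single[of V E Alice v a] a V by simp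
  qed
qed

end

section \<open>Caterpillars\<close>

text \<open>Indexing spine and leaf sets by functions turns reversing and shortening the spine into
  reindexing.\<close>

locale spine =
  fixes V :: "'a set" and E :: "'a set set" and p :: "nat \<Rightarrow> 'a" and s :: nat
    and L :: "nat \<Rightarrow> 'a set"
  assumes p_inj: "i < s \<Longrightarrow> j < s \<Longrightarrow> p i = p j \<longleftrightarrow> i = j"
    and finite_L: "j < s \<Longrightarrow> finite (L j)"
    and p_notin_L: "i < s \<Longrightarrow> j < s \<Longrightarrow> p i \<notin> L j"
    and L_disjoint: "i < s \<Longrightarrow> j < s \<Longrightarrow> x \<in> L i \<Longrightarrow> x \<in> L j \<Longrightarrow> i = j"
    and V_eq: "V = p ` {..<s} \<union> (\<Union>j<s. L j)"
    and E_eq: "E = (\<lambda>i. {p i, p (Suc i)}) ` {i. Suc i < s} \<union> (\<Union>j<s. (\<lambda>x. {p j, x}) ` L j)"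
begin

lemma L_neq: "x \<in> L j \<Longrightarrow> i < s \<Longrightarrow> j < s \<Longrightarrow> x \<noteq> p i" "x \<in> L j \<Longrightarrow> i < s \<Longrightarrow> j < s \<Longrightarrow> p i \<noteq> x"
  using p_notin_L by blast+

lemma L_neq_L: "x \<in> L i \<Longrightarrow> y \<in> L j \<Longrightarrow> i \<noteq> j \<Longrightarrow> i < s \<Longrightarrow> j < s \<Longrightarrow> x \<noteq> y"
  using L_disjoint by blast

sublocale finite_graph V E
proof
  have "finite {i. Suc i < s}" by (rule finite_subset[of _ "{..<s}"]) auto
  then show "finite E" unfolding E_eq using finite_L by auto
  fix e assume "e \<in> E"
  then consider i where "Suc i < s" "e = {p i, p (Suc i)}" | j x where "j < s" "x \<in> L j" "e = {p j, x}"
    unfolding E_eq by auto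
  then show "\<exists>x y. x \<in> V \<and> y \<in> V \<and> x \<noteq> y \<and> e = {x, y}"
  proof cases
    case 1
    then have "p i \<noteq> p (Suc i)" using p_inj[of i "Suc i"] by simp
    moreover have "p i \<in> V" "p (Suc i) \<in> V" using 1 unfolding V_eq by auto
    ultimately show ?thesis using 1(2) by blast
  next
    case 2
    then have "p j \<noteq> x" "p j \<in> V" "x \<in> V" using p_notin_L unfolding V_eq by auto
    then show ?thesis using 2(3) by blast
  qed
qed

section \<open>Adjacency in a caterpillar\<close>

lemma adjE:
  assumes "adj x y"
  obtains (path) i where "Suc i < s" "{x, y} = {p i, p (Suc i)}"
  | (leaf) j z where "j < s" "z \<in> L j" "{x, y} = {p j, z}"
  using assms unfolding E_eq by blast

lemma p_in_V: "i < s \<Longrightarrow> p i \<in> V" and L_in_V: "i < s \<Longrightarrow> x \<in> L i \<Longrightarrow> x \<in> V"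
  unfolding V_eq by auto

lemma adj_p_Suc: "Suc i < s \<Longrightarrow> adj (p i) (p (Suc i))"
  unfolding E_eq by blast

lemma adj_p_leaf: "j < s \<Longrightarrow> x \<in> L j \<Longrightarrow> adj (p j) x"
  unfolding E_eq by blast

lemma adj_p_p:
  assumes "i < s" "j < s"
  shows "adj (p i) (p j) \<longleftrightarrow> j = Suc i \<or> i = Suc j"
proof
  assume "adj (p i) (p j)"
  then show "j = Suc i \<or> i = Suc j"
  proof (cases rule: adjE)
    case (path k)
    then show ?thesis using assms by (auto simp: doubleton_eq_iff p_inj)
  next
    case (leaf k z)
    then show ?thesis using assms L_neq[of z k i] L_neq[of z k j] by (auto simp: doubleton_eq_iff)
  qed
next
  assume "j = Suc i \<or> i = Suc j"
  then show "adj (p i) (p j)" using adj_p_Suc adj_sym assms by blast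
qed

lemma adj_p_L:
  assumes "i < s" "j < s" "x \<in> L j"
  shows "adj (p i) x \<longleftrightarrow> i = j"
proof
  assume "adj (p i) x"
  then show "i = j"
  proof (cases rule: adjE)
    case (path k)
    then show ?thesis using assms L_neq[of x j k] L_neq[of x j "Suc k"]
      by (auto simp: doubleton_eq_iff)
  next
    case (leaf k z)
    then show ?thesis using assms L_neq[of z k i] L_disjoint[of k j x]
      by (auto simp: doubleton_eq_iff p_inj)
  qed
qed (use adj_p_leaf assms in blast)

lemma adj_L_p: "i < s \<Longrightarrow> j < s \<Longrightarrow> x \<in> L j \<Longrightarrow> adj x (p i) \<longleftrightarrow> i = j"
  using adj_p_L[of i j x] by (simp add: insert_commute)

lemma not_adj_L_L:
  assumes "i < s" "j < s" "x \<in> L i" "y \<in> L j"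
  shows "\<not> adj x y"
proof
  assume "adj x y"
  then show False
  proof (cases rule: adjE)
    case (path k)
    then show ?thesis using assms L_neq[of x i k] L_neq[of x i "Suc k"]
      by (auto simp: doubleton_eq_iff)
  next
    case (leaf k z)
    then show ?thesis using assms L_neq[of x i k] L_neq[of y j k]
      by (auto simp: doubleton_eq_iff)
  qed
qed

lemma vertexE:
  assumes "v \<in> V"
  obtains (spine) i where "i < s" "v = p i" | (leaf) i where "i < s" "v \<in> L i"
  using assms unfolding V_eq by blast

lemma leaf_adj_imp: "j < s \<Longrightarrow> x \<in> L j \<Longrightarrow> adj x y \<Longrightarrow> y = p j"
  by (rule vertexE[of y]) (use adj_in_V adj_L_p not_adj_L_L in blast)+

lemma spine_adj_imp:
  assumes "i < s" "adj (p i) y"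
  shows "y \<in> L i \<or> (\<exists>j<s. y = p j \<and> (j = Suc i \<or> i = Suc j))"
  using adj_in_V[OF assms(2)] assms adj_p_p adj_p_L by (metis vertexE)

lemma pendant_leaf: "j < s \<Longrightarrow> x \<in> L j \<Longrightarrow> pendant x (p j)"
  unfolding pendant_def using adj_L_p leaf_adj_imp by blast

section \<open>Changing the spine\<close>

text \<open>Reading the spine from its other end lets arguments about one end serve for
  both.\<close>

lemma reverse: "spine V E (\<lambda>i. p (s - 1 - i)) s (\<lambda>j. L (s - 1 - j))"
proof
  let ?r = "\<lambda>i. s - 1 - i"
  have r: "?r ` {..<s} = {..<s}"
  proof
    show "{..<s} \<subseteq> ?r ` {..<s}"
    proof
      fix x assume "x \<in> {..<s}"
      then have "x = ?r (?r x)" "?r x \<in> {..<s}" by auto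
      then show "x \<in> ?r ` {..<s}" by blast
    qed
  qed auto
  have "(\<lambda>i. p (?r i)) ` {..<s} = p ` ?r ` {..<s}" "(\<Union>j<s. L (?r j)) = (\<Union>j \<in> ?r ` {..<s}. L j)"
    by (auto simp only: image_image)
  then show "V = (\<lambda>i. p (?r i)) ` {..<s} \<union> (\<Union>j<s. L (?r j))" by (simp only: r V_eq)
  have 1: "(\<Union>j<s. (\<lambda>x. {p (?r j), x}) ` L (?r j)) = (\<Union>j<s. (\<lambda>x. {p j, x}) ` L j)"
    using arg_cong[OF r, of "\<lambda>A. \<Union>j\<in>A. (\<lambda>x. {p j, x}) ` L j"] by (simp only: image_image)
  have 2: "(\<lambda>i. {p (?r i), p (?r (Suc i))}) ` {i. Suc i < s} = (\<lambda>i. {p i, p (Suc i)}) ` {i. Suc i < s}"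
  proof (intro set_eqI iffI)
    fix e assume "e \<in> (\<lambda>i. {p (?r i), p (?r (Suc i))}) ` {i. Suc i < s}"
    then obtain i where "Suc i < s" "e = {p (?r i), p (?r (Suc i))}" by blast
    \<comment> \<open>Here \<open>Suc i < s\<close> keeps the truncated subtraction exact, so
      consecutive indices stay consecutive.\<close>
    moreover from this have "?r i = Suc (?r (Suc i))" by auto
    ultimately show "e \<in> (\<lambda>i. {p i, p (Suc i)}) ` {i. Suc i < s}"
      by (intro image_eqI[of _ _ "?r (Suc i)"]) auto
  next
    fix e assume "e \<in> (\<lambda>i. {p i, p (Suc i)}) ` {i. Suc i < s}"
    then obtain i where i: "Suc i < s" "e = {p i, p (Suc i)}" by blast
    have "?r (?r (Suc i)) = Suc i" "?r (Suc (?r (Suc i))) = i" using i by auto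
    then show "e \<in> (\<lambda>i. {p (?r i), p (?r (Suc i))}) ` {i. Suc i < s}"
      using i by (intro image_eqI[of _ _ "?r (Suc i)"]) (simp_all only: insert_commute, auto)
  qed
  show "E = (\<lambda>i. {p (?r i), p (?r (Suc i))}) ` {i. Suc i < s} \<union> (\<Union>j<s. (\<lambda>x. {p (?r j), x}) ` L (?r j))"
    unfolding 1 2 by (rule E_eq)
  show "i = j" if "i < s" "j < s" "x \<in> L (?r i)" "x \<in> L (?r j)" for i j x
    using L_disjoint[of "?r i" "?r j" x] that by auto
qed (auto simp: p_inj finite_L p_notin_L)

text \<open>An end of the spine without leaves is itself a leaf of its spine neighbour, so it can
  move from the spine into that leaf set.\<close>

lemma shrink:
  assumes s: "s = Suc n" "1 \<le> n" and L0: "L 0 = {}"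
  shows "spine V E (\<lambda>i. p (Suc i)) n (\<lambda>j. if j = 0 then insert (p 0) (L 1) else L (Suc j))"
    (is "spine V E ?p n ?L")
proof
  have mem: "x \<in> ?L j \<longleftrightarrow> x \<in> L (Suc j) \<or> j = 0 \<and> x = p 0" for x j by auto
  show "?p i = ?p j \<longleftrightarrow> i = j" if "i < n" "j < n" for i j
    using p_inj[of "Suc i" "Suc j"] that s by simp
  show "finite (?L j)" if "j < n" for j using finite_L that s by simp
  show "?p i \<notin> ?L j" if "i < n" "j < n" for i j
    unfolding mem using p_notin_L[of "Suc i" "Suc j"] p_inj[of "Suc i" 0] that s by auto
  show "i = j" if "i < n" "j < n" "x \<in> ?L i" "x \<in> ?L j" for i j x
    using that L_disjoint[of "Suc i" "Suc j" x] p_notin_L[of 0 "Suc i"] p_notin_L[of 0 "Suc j"] s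
    unfolding mem by auto
  have U: "x \<in> (\<Union>j<n. ?L j) \<longleftrightarrow> x = p 0 \<or> x \<in> (\<Union>j<s. L j)" for x
  proof
    assume "x \<in> (\<Union>j<n. ?L j)"
    then obtain j where "j < n" "x \<in> ?L j" by blast
    then show "x = p 0 \<or> x \<in> (\<Union>j<s. L j)" unfolding mem using s by auto
  next
    assume "x = p 0 \<or> x \<in> (\<Union>j<s. L j)"
    then show "x \<in> (\<Union>j<n. ?L j)"
    proof
      assume "x = p 0"
      then show ?thesis using s by (intro UN_I[of 0]) auto
    next
      assume "x \<in> (\<Union>j<s. L j)"
      then obtain j where j: "j < s" "x \<in> L j" by blast
      then obtain k where "j = Suc k" using L0 by (cases j) auto
      then show ?thesis using j s by (intro UN_I[of k]) auto
    qed
  qed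
  have "{..<s} = insert 0 (Suc ` {..<n})" using s by (simp add: lessThan_Suc_eq_insert_0)
  then have P: "p ` {..<s} = insert (p 0) (?p ` {..<n})" by (simp add: image_image)
  have "(\<Union>j<n. ?L j) = insert (p 0) (\<Union>j<s. L j)"
    by (rule set_eqI) (simp only: U insert_iff)
  then show "V = ?p ` {..<n} \<union> (\<Union>j<n. ?L j)" by (simp only: V_eq P) simp
  show "E = (\<lambda>i. {?p i, ?p (Suc i)}) ` {i. Suc i < n} \<union> (\<Union>j<n. (\<lambda>x. {?p j, x}) ` ?L j)" (is "_ = ?R")
  proof (intro set_eqI iffI)
    fix e assume "e \<in> E"
    then consider i where "Suc i < s" "e = {p i, p (Suc i)}" | j x where "j < s" "x \<in> L j" "e = {p j, x}"
      unfolding E_eq by auto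
    then show "e \<in> ?R"
    proof cases
      case 1
      show ?thesis
      proof (cases i)
        \<comment> \<open>The first spine edge becomes the edge to the new leaf
          \<open>p 0\<close>.\<close>
        case 0
        then have "e = {?p 0, p 0}" "p 0 \<in> ?L 0" "0 < n" using 1 s by auto
        then show ?thesis by blast
      next
        case (Suc k)
        then show ?thesis using 1 s by auto
      qed
    next
      case 2
      then obtain k where "j = Suc k" using L0 by (cases j) auto
      then have "e = {?p k, x}" "x \<in> ?L k" "k < n" using 2 s by auto
      then show ?thesis by blast
    qed
  next
    fix e assume "e \<in> ?R"
    then consider i where "Suc i < n" "e = {?p i, ?p (Suc i)}"
      | j x where "j < n" "x \<in> ?L j" "e = {?p j, x}" by blast
    then show "e \<in> E"
    proof cases
      case 1
      then show ?thesis using adj_p_Suc[of "Suc i"] s by simp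
    next
      case 2
      then consider "x \<in> L (Suc j)" | "j = 0" "x = p 0" unfolding mem by blast
      then show ?thesis
      proof cases
        case 1
        then show ?thesis using 2 adj_p_leaf[of "Suc j" x] s by simp
      next
        case c: 2
        then show ?thesis using 2(3) adj_sym[OF adj_p_Suc[of 0]] s by simp
      qed
    qed
  qed
qed

end

section \<open>Caterpillars with leaves at both ends of the spine\<close>

text \<open>A normal form, symmetric under reversal: both ends offer Bob a leaf for his label
  \<open>0\<close>, far from the opposite end.\<close>

locale proper_spine = spine +
  assumes two_le: "2 \<le> s" and first_nonempty: "L 0 \<noteq> {}" and last_nonempty: "L (s - 1) \<noteq> {}"
begin

lemma reverse_proper: "proper_spine V E (\<lambda>i. p (s - 1 - i)) s (\<lambda>j. L (s - 1 - j))"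
  using reverse two_le first_nonempty last_nonempty
  by (simp add: proper_spine_def proper_spine_axioms_def)

lemma other_leaf:
  obtains j x where "j < s" "j \<noteq> i" "x \<in> L j"
proof (cases "i = 0")
  case True
  then show ?thesis using that[of "s - 1"] two_le last_nonempty by auto
next
  case False
  then show ?thesis using that[of 0] two_le first_nonempty by auto
qed

lemma non_neighbour:
  assumes "v \<in> V"
  shows "\<exists>x\<in>V. x \<noteq> v \<and> \<not> adj v x"
  using assms
proof (cases rule: vertexE)
  case (spine i)
  obtain j x where "j < s" "j \<noteq> i" "x \<in> L j" by (rule other_leaf)
  then show ?thesis using spine adj_p_L[of i j x] L_neq[of x j i] L_in_V by blast
next
  case (leaf i)
  obtain j x where "j < s" "j \<noteq> i" "x \<in> L j" by (rule other_leaf)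
  then show ?thesis using leaf not_adj_L_L[of i j v x] L_neq_L[of x j v i] L_in_V by blast
qed

lemma card_E_ge_3: "3 \<le> card E"
proof -
  obtain l x where l: "l \<in> L 0" and x: "x \<in> L (s - 1)" using first_nonempty last_nonempty by blast
  have lt: "0 < s" "1 < s" "s - 1 < s" using two_le by auto
  let ?A = "{{p 0, l}, {p 0, p 1}, {p (s - 1), x}}"
  have "?A \<subseteq> E" using adj_p_leaf[OF lt(1) l] adj_p_leaf[OF lt(3) x] adj_p_Suc[of 0] lt by simp
  moreover have "card ?A = 3"
    using L_neq[OF l lt(1,1)] L_neq[OF l lt(2,1)] L_neq[OF l lt(3,1)] L_neq[OF x lt(1,3)]
      L_neq[OF x lt(2,3)] L_neq_L[OF l x] lt by (simp add: doubleton_eq_iff)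
  ultimately show ?thesis using card_mono[OF finite_E] by metis
qed

lemma card_E_ge_4:
  assumes "3 \<le> s"
  shows "4 \<le> card E"
proof -
  obtain l x where l: "l \<in> L 0" and x: "x \<in> L (s - 1)" using first_nonempty last_nonempty by blast
  have lt: "0 < s" "1 < s" "s - 1 < s" "2 < s" using assms by auto
  let ?A = "{{p 0, l}, {p 0, p 1}, {p 1, p 2}, {p (s - 1), x}}"
  have "?A \<subseteq> E" using adj_p_leaf[OF lt(1) l] adj_p_leaf[OF lt(3) x] adj_p_Suc[of 0] adj_p_Suc[of 1] lt
    by (simp add: numeral_2_eq_2)
  moreover have "card ?A = 4"
    using L_neq[OF l lt(1,1)] L_neq[OF l lt(2,1)] L_neq[OF l lt(3,1)] L_neq[OF x lt(1,3)]
      L_neq[OF x lt(2,3)] L_neq[OF l lt(4,1)] L_neq[OF x lt(4,3)] L_neq_L[OF l x] lt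
      p_inj[of 0 1] p_inj[of 0 2] p_inj[of 1 2] by (simp add: doubleton_eq_iff)
  ultimately show ?thesis using card_mono[OF finite_E] by metis
qed

lemma bob_first: "bob_wins V E Bob []"
proof -
  obtain l x where l: "l \<in> L 0" and x: "x \<in> L (s - 1)" using first_nonempty last_nonempty by blast
  have lt: "0 < s" "1 < s" "s - 1 < s" using two_le by auto
  have V: "x \<in> V" "p 1 \<in> V" using L_in_V[OF lt(3) x] p_in_V lt by auto
  have n: "x \<noteq> l" "x \<noteq> p 0" "x \<noteq> p 1" "p 1 \<noteq> l" "p 1 \<noteq> p 0"
    using L_neq_L[OF x l] L_neq[OF x lt(1,3)] L_neq[OF x lt(2,3)] L_neq[OF l lt(2,1)] p_inj[of 1 0] lt
    by auto
  show ?thesis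
  proof (rule bob_first_wins[OF pendant_leaf[OF lt(1) l], of x])
    show "\<not> adj (p 0) x" using adj_p_L[OF lt(1,3) x] lt by simp
    \<comment> \<open>Besides \<open>l\<close> and \<open>p 0\<close> there are \<open>x\<close> and
      \<open>p 1\<close>, and \<open>y\<close> can equal only one of them.\<close>
    show "\<exists>z\<in>V - {l, p 0, y}. True" for y using V n by (cases "y = x") auto
  qed (use V n card_E_ge_3 in auto)
qed

text \<open>Bob uses a leaf at \<open>p 0\<close>. The far leaf \<open>x\<close> is adjacent only to
  \<open>p (s - 1)\<close>, which is beyond \<open>p (Suc i)\<close>; so \<open>x\<close> avoids
  \<open>p i\<close> and all its neighbours.\<close>

lemma wins_inner:
  assumes i: "Suc (Suc i) < s" and Li: "L i = {}" and a: "a \<noteq> 0" "a < card E"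
  shows "bob_wins V E Alice [(p i, a)]"
proof -
  obtain l x where l: "l \<in> L 0" and x: "x \<in> L (s - 1)" using first_nonempty last_nonempty by blast
  have lt: "0 < s" "s - 1 < s" "i < s" "Suc i < s" using i by auto
  have i0: "i \<noteq> 0" using Li first_nonempty by auto
  show ?thesis
  proof (rule bob_wins_far_pendant[OF pendant_leaf[OF lt(1) l], of _ x "p (Suc i)"])
    show "p i \<in> V" "x \<in> V" "p (Suc i) \<in> V" using p_in_V L_in_V[OF lt(2) x] lt by auto
    show "p i \<noteq> l" "p i \<noteq> p 0" "x \<noteq> l" "x \<noteq> p 0" "x \<noteq> p i"
      using L_neq[OF l lt(3,1)] p_inj[OF lt(3,1)] i0 L_neq_L[OF x l] L_neq[OF x lt(1,2)]
        L_neq[OF x lt(3,2)] i by auto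
    show "\<not> adj (p 0) x" using adj_p_L[OF lt(1,2) x] i by simp
    show "p (Suc i) \<notin> {p i, l, p 0, x}"
      using L_neq[OF l lt(4,1)] L_neq[OF x lt(4,2)] p_inj[OF lt(4,1)] p_inj[OF lt(4,3)] by auto
    show "4 \<le> card E" using card_E_ge_4 i by simp
    fix y assume "adj (p i) y" "y \<noteq> p 0"
    then obtain j where j: "j < s" "y = p j" "j = Suc i \<or> i = Suc j"
      using spine_adj_imp[OF lt(3)] Li by blast
    show "\<exists>x \<in> V - {p i, l, p 0, y}. \<not> adj x (p i) \<and> \<not> adj x y"
    proof (intro bexI[of _ x] conjI)
      show "\<not> adj x (p i)" using adj_L_p[OF lt(3,2) x] i by simp
      show "\<not> adj x y" using adj_L_p[OF j(1) lt(2) x] j i by auto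
      show "x \<in> V - {p i, l, p 0, y}"
        using L_in_V[OF lt(2) x] L_neq[OF x lt(3,2)] L_neq_L[OF x l] L_neq[OF x lt(1,2)]
          L_neq[OF x j(1) lt(2)] j i by auto
    qed
  qed (use a in auto)
qed

text \<open>Here a leaf at \<open>p 2\<close> is adjacent to a neighbour of \<open>p 1\<close>. A
  second leaf at \<open>p 0\<close> takes over its part as the vertex away from the edge from
  \<open>p 1\<close> to \<open>p 2\<close>; without one, \<open>p 0\<close> has degree two.\<close>

lemma wins_middle:
  assumes s: "s = 3" and L1: "L 1 = {}" and a: "a \<noteq> 0" "a < card E"
  shows "bob_wins V E Alice [(p 1, a)]"
proof -
  obtain l x where l: "l \<in> L 0" and x: "x \<in> L 2" using first_nonempty last_nonempty s by auto
  have lt: "0 < s" "1 < s" "2 < s" using s by auto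
  have V: "p 1 \<in> V" "x \<in> V" "p 2 \<in> V" using p_in_V L_in_V[OF lt(3) x] lt by auto
  have pn: "p 1 \<noteq> p 0" "p 2 \<noteq> p 0" "p 2 \<noteq> p 1"
    using p_inj[OF lt(2,1)] p_inj[OF lt(3,1)] p_inj[OF lt(3,2)] by auto
  have l1: "p 1 \<noteq> l" using L_neq[OF l lt(2,1)] by simp
  show ?thesis
  proof (cases "\<exists>l'\<in>L 0. l' \<noteq> l")
    case True
    then obtain l' where l': "l' \<in> L 0" "l' \<noteq> l" by blast
    show ?thesis
    proof (rule bob_wins_far_pendant[OF pendant_leaf[OF lt(1) l], of _ x "p 2"])
      show "x \<noteq> l" "x \<noteq> p 0" "x \<noteq> p 1"
        using L_neq_L[OF x l] L_neq[OF x lt(1,3)] L_neq[OF x lt(2,3)] lt by auto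
      show "\<not> adj (p 0) x" using adj_p_L[OF lt(1,3) x] by simp
      show "p 2 \<notin> {p 1, l, p 0, x}"
        using L_neq[OF l lt(3,1)] L_neq[OF x lt(3,3)] pn by auto
      show "4 \<le> card E" using card_E_ge_4 s by simp
      fix y assume "adj (p 1) y" "y \<noteq> p 0"
      then have y: "y = p 2"
        using spine_adj_imp[OF lt(2), of y] L1 by (auto simp: numeral_2_eq_2)
      show "\<exists>x \<in> V - {p 1, l, p 0, y}. \<not> adj x (p 1) \<and> \<not> adj x y"
      proof (intro bexI[of _ l'] conjI)
        show "\<not> adj l' (p 1)" using adj_L_p[OF lt(2,1) l'(1)] by simp
        show "\<not> adj l' y" using adj_L_p[OF lt(3,1) l'(1)] y by simp
        show "l' \<in> V - {p 1, l, p 0, y}"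
          using L_in_V[OF lt(1) l'(1)] L_neq[OF l'(1) lt(1,1)] L_neq[OF l'(1) lt(2,1)]
            L_neq[OF l'(1) lt(3,1)] y l' by auto
      qed
    qed (use a V l1 pn in auto)
  next
    case False
    show ?thesis
    proof (rule bob_wins_pendant_degree_two[OF pendant_leaf[OF lt(1) l] V(1) l1])
      fix x assume "adj (p 0) x"
      then show "x = l \<or> x = p 1" using spine_adj_imp[OF lt(1)] False by auto
    qed (use card_E_ge_3 a in auto)
  qed
qed

text \<open>Bob uses the twin \<open>l\<close>. The only neighbour of \<open>v\<close> is then
  \<open>w\<close> itself, so the condition on other neighbours of \<open>v\<close> is
  vacuous.\<close>

lemma wins_twin_leaf:
  assumes i: "i < s" "v \<in> L i" "l \<in> L i" "v \<noteq> l" and a: "a \<noteq> 0" "a < card E"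
  shows "bob_wins V E Alice [(v, a)]"
proof -
  obtain j x where j: "j < s" "j \<noteq> i" and x: "x \<in> L j" by (rule other_leaf)
  have lt: "0 < s" "1 < s" using two_le by auto
  have n: "x \<noteq> l" "x \<noteq> v" "x \<noteq> p i" "x \<noteq> p j" "v \<noteq> p i" "v \<noteq> p j" "l \<noteq> p i" "l \<noteq> p j"
    "p j \<noteq> p i"
    using L_neq_L[OF x i(3)] L_neq_L[OF x i(2)] L_neq[OF x] L_neq[OF i(2)] L_neq[OF i(3)] p_inj i j
    by auto
  show ?thesis
  proof (rule bob_wins_far_pendant[OF pendant_leaf[OF i(1,3)], of _ x "p j"])
    show "v \<in> V" "x \<in> V" "p j \<in> V" using p_in_V L_in_V i j x by auto
    show "\<not> adj (p i) x" using adj_p_L[OF i(1) j(1) x] j by simp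
    show "p j \<notin> {v, l, p i, x}" using n by auto
    show "\<exists>x\<in>V - {v, l, p i, y}. \<not> adj x v \<and> \<not> adj x y" if "adj v y" "y \<noteq> p i" for y
      using leaf_adj_imp[OF i(1,2)] that by blast
    let ?A = "{{p i, v}, {p i, l}, {p j, x}, {p 0, p 1}}"
    have "?A \<subseteq> E"
      using adj_p_leaf[OF i(1,2)] adj_p_leaf[OF i(1,3)] adj_p_leaf[OF j(1) x] adj_p_Suc[of 0] lt by simp
    moreover have "card ?A = 4"
      using n i(4) L_neq[OF x lt(1) j(1)] L_neq[OF x lt(2) j(1)] L_neq[OF i(2) lt(1) i(1)]
        L_neq[OF i(2) lt(2) i(1)] L_neq[OF i(3) lt(1) i(1)] L_neq[OF i(3) lt(2) i(1)]
      by (simp add: doubleton_eq_iff)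
    ultimately show "4 \<le> card E" using card_mono[OF finite_E] by metis
  qed (use n i(4) a in auto)
qed

text \<open>Bob uses a leaf \<open>l\<close> at the far end. The only neighbour of \<open>v\<close>
  is \<open>p i\<close>, so one more vertex away from \<open>v\<close> and \<open>p i\<close> has to
  be found; the star with one subdivided edge and the path on five vertices are treated
  separately.\<close>

lemma wins_single_leaf:
  assumes i: "Suc i < s" and Li: "L i = {v}" and a: "a \<noteq> 0" "a < card E"
  shows "bob_wins V E Alice [(v, a)]"
proof -
  obtain l where l: "l \<in> L (s - 1)" using last_nonempty by blast
  have lt: "0 < s" "1 < s" "s - 1 < s" "i < s" using i by auto
  have v: "v \<in> L i" using Li by simp
  have VV: "v \<in> V" using L_in_V[OF lt(4) v] .
  have vl: "v \<noteq> l" using L_neq_L[OF v l] i by auto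
  have vp: "v \<noteq> p k" if "k < s" for k using L_neq[OF v that lt(4)] by simp
  have lp: "l \<noteq> p k" if "k < s" for k using L_neq[OF l that lt(3)] by simp
  have pend: "pendant l (p (s - 1))" using pendant_leaf[OF lt(3) l] .
  show ?thesis
  proof (cases "s = 2")
    \<comment> \<open>With two spine vertices, \<open>v\<close> is the only leaf at
      \<open>p 0\<close>, so every edge except the one at \<open>v\<close> meets
      \<open>p 1\<close>.\<close>
    case True
    then have i0: "i = 0" using i by simp
    show ?thesis
    proof (rule bob_wins_broom[OF pend VV vl vp[OF lt(3)], of "p i"])
      show "\<not> adj (p (s - 1)) v" using adj_p_L[OF lt(3,4) v] i by simp
      show "adj v (p i)" using adj_L_p[OF lt(4,4) v] by simp
      show "p i \<noteq> l" using lp lt by metis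
      show "x = p (s - 1) \<or> y = p (s - 1) \<or> {x, y} = {v, p i}" if "adj x y" for x y
        using that
      proof (cases rule: adjE)
        case (path k)
        then show ?thesis using True by (auto simp: doubleton_eq_iff)
      next
        case (leaf k z)
        then have "k = 1 \<or> k = 0" using True by auto
        then show ?thesis using leaf True Li i0 by (auto simp: doubleton_eq_iff)
      qed
    qed (use card_E_ge_3 a in auto)
  next
    case False
    then have s3: "3 \<le> s" using two_le by simp
    have far: "bob_wins V E Alice [(v, a)]"
      if x: "x \<in> V" "x \<notin> {v, l, p (s - 1), p i}" "\<not> adj x v" "\<not> adj x (p i)" for x
    proof (rule bob_wins_far_pendant[OF pend VV vl vp[OF lt(3)], of "p 0" "p 1"])
      show "p 0 \<in> V" "p 1 \<in> V" using p_in_V lt by auto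
      show "p 0 \<noteq> l" "p 0 \<noteq> v" using lp[OF lt(1)] vp[OF lt(1)] by auto
      show "p 0 \<noteq> p (s - 1)" using p_inj[OF lt(1,3)] s3 by simp
      show "\<not> adj (p (s - 1)) (p 0)" using adj_p_p[OF lt(3,1)] s3 by simp
      show "p 1 \<notin> {v, l, p (s - 1), p 0}"
        using vp[OF lt(2)] lp[OF lt(2)] p_inj[OF lt(2,3)] p_inj[OF lt(2,1)] s3 by auto
      show "4 \<le> card E" using card_E_ge_4 s3 .
      show "\<exists>x\<in>V - {v, l, p (s - 1), y}. \<not> adj x v \<and> \<not> adj x y" if "adj v y" for y
        using leaf_adj_imp[OF lt(4) v that] x by blast
    qed (use a in auto)
    show ?thesis
    proof (cases "\<exists>k<s. \<exists>x\<in>L k. x \<noteq> v \<and> x \<noteq> l")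
      \<comment> \<open>A third leaf hangs at another spine vertex than \<open>p i\<close>, so it is
        the required vertex.\<close>
      case True
      then obtain k x where k: "k < s" and x: "x \<in> L k" "x \<noteq> v" "x \<noteq> l" by blast
      then have "k \<noteq> i" using Li by auto
      then show ?thesis
        using far[of x] L_in_V[OF k x(1)] x L_neq[OF x(1) lt(3) k] L_neq[OF x(1) lt(4) k]
          not_adj_L_L[OF k lt(4) x(1) v] adj_L_p[OF lt(4) k x(1)] by auto
    next
      \<comment> \<open>With no leaves but \<open>v\<close> and \<open>l\<close>, the graph is a
        path with end \<open>v\<close>: five vertices if \<open>s = 3\<close>, and otherwise
        \<open>p 2\<close> is an inner spine vertex away from \<open>p 0\<close>.\<close>
      case only: False
      obtain l0 where l0: "l0 \<in> L 0" using first_nonempty by blast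
      have "l0 \<noteq> l" using L_neq_L[OF l0 l] s3 by auto
      then have "l0 = v" using only l0 lt by blast
      then have i0: "i = 0" using L_disjoint[OF lt(1,4)] l0 v by blast
      show ?thesis
      proof (cases "s = 3")
        case s: True
        have L: "L 0 = {v}" "L 1 = {}" "L 2 = {l}"
        proof -
          show "L 0 = {v}" using Li i0 by simp
          have "v \<notin> L 1" "v \<notin> L 2" "l \<notin> L 1"
            using L_neq_L[OF v, of v 1] L_neq_L[OF v, of v 2] L_neq_L[OF l, of l 1] i0 s by auto
          moreover have "\<forall>x\<in>L 1. x = v \<or> x = l" "\<forall>x\<in>L 2. x = v \<or> x = l" "l \<in> L 2"
            using only[simplified, rule_format, of 1] only[simplified, rule_format, of 2] l s by auto
          ultimately show "L 1 = {}" "L 2 = {l}" unfolding set_eq_iff singleton_iff empty_iff by metis+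
        qed
        have I: "{i. Suc i < s} = {0, 1}" "{..<s} = {0, 1, 2}" using s by auto
        have "E = {{v, p 0}, {p 0, p 1}, {p 1, p 2}, {p 2, l}}"
          unfolding E_eq I image_insert image_empty UN_insert UN_empty L insert_commute[of v "p 0" "{}"]
            Suc_1 One_nat_def[symmetric] by blast
        moreover have "distinct [v, p 0, p 1, p 2, l]"
          using vp[of 0] vp[of 1] vp[of 2] lp[of 0] lp[of 1] lp[of 2] vl p_inj[of 0 1] p_inj[of 0 2]
            p_inj[of 1 2] s by auto
        ultimately show ?thesis using bob_wins_end_of_path5 a by blast
      next
        case False
        then have lt2: "2 < s" "3 < s" using s3 by auto
        show ?thesis
        proof (rule far[of "p 2"])
          show "p 2 \<in> V" using p_in_V lt2 by blast
          show "p 2 \<notin> {v, l, p (s - 1), p i}"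
            using vp[OF lt2(1)] lp[OF lt2(1)] p_inj[OF lt2(1) lt(3)] p_inj[OF lt2(1) lt(1)] i0 lt2 by auto
          show "\<not> adj (p 2) v" using adj_p_L[OF lt2(1) lt(4) v] i0 by simp
          show "\<not> adj (p 2) (p i)" using adj_p_p[OF lt2(1) lt(4)] i0 by simp
        qed
      qed
    qed
  qed
qed

lemma alice_first_move:
  assumes v: "v \<in> V" and a: "a \<noteq> 0" "a < card E"
  shows "bob_wins V E Alice [(v, a)]"
proof -
  interpret rev: proper_spine V E "\<lambda>i. p (s - 1 - i)" s "\<lambda>j. L (s - 1 - j)"
    by (rule reverse_proper)
  from v show ?thesis
  proof (cases rule: vertexE)
    case (spine i)
    show ?thesis
    proof (cases "L i = {}")
      case False
      then obtain l where "l \<in> L i" by blast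
      then show ?thesis
        using bob_wins_pendant_neighbour[OF pendant_leaf[of i l]] spine card_E_ge_3 a by simp
    next
      case True
      then have i: "i \<noteq> 0" "i \<noteq> s - 1" using first_nonempty last_nonempty by auto
      \<comment> \<open>A leafless inner vertex lies at least two steps from the last or from the
        first spine vertex, unless it is the middle of three. The second alternative is the first
        one read backwards.\<close>
      consider "Suc (Suc i) < s" | "s = 3" "i = 1" | "1 < i" using i spine(1) by linarith
      then show ?thesis
      proof cases
        case 1
        then show ?thesis using wins_inner True spine(2) a by blast
      next
        case 2
        then show ?thesis using wins_middle True spine(2) a by blast
      next
        case 3
        then have "s - 1 - (s - 1 - i) = i" "Suc (Suc (s - 1 - i)) < s" using spine(1) by auto
        then show ?thesis using rev.wins_inner[of "s - 1 - i"] True spine(2) a by simp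
      qed
    qed
  next
    case (leaf i)
    show ?thesis
    proof (cases "\<exists>l\<in>L i. v \<noteq> l")
      case True
      then show ?thesis using wins_twin_leaf leaf a by blast
    next
      case False
      have Li: "L i = {v}"
      proof
        show "L i \<subseteq> {v}" using False by (metis singletonI subsetI)
        show "{v} \<subseteq> L i" using leaf(2) by blast
      qed
      show ?thesis
      proof (cases "Suc i < s")
        case True
        then show ?thesis using wins_single_leaf Li a by blast
      next
        \<comment> \<open>The last spine vertex becomes the first after reversal.\<close>
        case False
        then have "s - 1 - (s - 1 - i) = i" "Suc (s - 1 - i) < s" using leaf(1) two_le by auto
        then show ?thesis using rev.wins_single_leaf[of "s - 1 - i"] Li a by simp
      qed
    qed
  qed
qed

lemma alice_first: "bob_wins V E Alice []"
proof (rule bob_wins.alice)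
  show "to_move Alice [] = Alice" by (simp add: to_move_def)
  show "p 0 \<in> V" using p_in_V two_le by simp
  fix mv :: "'a move" assume L: "legal_move V E [] mv"
  obtain v a where mv: "mv = (v, a)" by force
  have v: "v \<in> V" "a \<le> card E" using L unfolding mv legal_move_def by auto
  have "bob_wins V E Alice [(v, a)]"
  proof (cases "a = 0 \<or> a = card E")
    case True
    obtain x where "x \<in> V" "x \<noteq> v" "\<not> adj v x" using non_neighbour v by blast
    then show ?thesis using bob_wins_extreme_label[of v x a] v True card_E_ge_3 by simp
  next
    case False
    then show ?thesis using alice_first_move v by simp
  qed
  then show "bob_wins V E Alice ([] @ [mv])" by (simp add: mv)
qed simp

end

section \<open>From caterpillars to the normal form\<close>

lemma is_cat_imp_spine:
  assumes "is_cat ks V E"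
  shows "\<exists>p L. spine V E p (length ks) L"
proof -
  obtain vs :: "'a list" and L where len: "length vs = length ks" and d: "distinct vs"
    and L: "\<forall>j < length ks. finite (L j) \<and> card (L j) = ks ! j \<and> L j \<inter> set vs = {}"
    and dis: "\<forall>i < length ks. \<forall>j < length ks. i \<noteq> j \<longrightarrow> L i \<inter> L j = {}"
    and V: "V = set vs \<union> (\<Union>j < length ks. L j)"
    and E: "E = {{vs ! i, vs ! Suc i} | i. Suc i < length ks} \<union>
            {{vs ! j, x} | j x. j < length ks \<and> x \<in> L j}"
    using assms unfolding is_cat_def by blast
  have "spine V E ((!) vs) (length ks) L"
  proof
    show "(vs ! i = vs ! j) = (i = j)" if "i < length ks" "j < length ks" for i j
      using nth_eq_iff_index_eq[OF d] that len by simp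
    show "finite (L j)" if "j < length ks" for j using L that by blast
    show "vs ! i \<notin> L j" if "i < length ks" "j < length ks" for i j
    proof -
      have "vs ! i \<in> set vs" using that len by simp
      then show ?thesis using L that by blast
    qed
    show "i = j" if "i < length ks" "j < length ks" "x \<in> L i" "x \<in> L j" for i j x
      using dis that by blast
    have "set vs = (!) vs ` {..<length ks}"
      using len by (metis atLeast_upt map_nth set_map)
    then show "V = (!) vs ` {..<length ks} \<union> (\<Union>j<length ks. L j)" using V by simp
    show "E = (\<lambda>i. {vs ! i, vs ! Suc i}) ` {i. Suc i < length ks} \<union>
        (\<Union>j<length ks. (\<lambda>x. {vs ! j, x}) ` L j)"
      unfolding E by blast
  qed
  then show ?thesis by blast
qed

text \<open>Leafless ends are absorbed one at a time, the last one after reversal, until both ends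
  carry leaves or a single spine vertex remains.\<close>

lemma spine_imp_proper_or_star:
  assumes "spine V E p s L" "1 \<le> s"
  shows "\<exists>p s L. spine V E p s L \<and> (s = 1 \<or> proper_spine V E p s L)"
  using assms
proof (induction s arbitrary: p L)
  case 0
  then show ?case by simp
next
  case (Suc n)
  consider "n = 0" | "1 \<le> n" "L 0 = {}" | "1 \<le> n" "L n = {}" | "1 \<le> n" "L 0 \<noteq> {}" "L n \<noteq> {}"
    by linarith
  then show ?case
  proof cases
    case 1
    then show ?thesis using Suc.prems by auto
  next
    case 2
    then show ?thesis using Suc.IH spine.shrink[OF Suc.prems(1) refl] by blast
  next
    case 3
    have "spine V E (\<lambda>i. p (Suc n - 1 - i)) (Suc n) (\<lambda>j. L (Suc n - 1 - j))"
      using spine.reverse[OF Suc.prems(1)] .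
    from spine.shrink[OF this refl 3(1)] have "\<exists>p L. spine V E p n L" using 3(2) by auto
    then show ?thesis using Suc.IH 3(1) by blast
  next
    case 4
    then have "proper_spine V E p (Suc n) L"
      using Suc.prems(1) by (simp add: proper_spine_def proper_spine_axioms_def)
    then show ?thesis using Suc.prems(1) by blast
  qed
qed

text \<open>Any two vertices are joined by a walk of at most two edges through the centre
  \<open>p 0\<close>. This excludes the case of a single spine vertex.\<close>

lemma diameter_star:
  assumes "spine V E p 1 L"
  shows "diameter V E \<le> 2"
proof -
  interpret spine V E p 1 L by fact
  have V: "V = insert (p 0) (L 0)" unfolding V_eq by auto
  have adj: "{p 0, x} \<in> E" "{x, p 0} \<in> E" if "x \<in> L 0" for x
    using adj_p_leaf[of 0 x] adj_sym that by auto
  have le: "graph_dist V E u v \<le> 2" if uv: "u \<in> V" "v \<in> V" for u v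
  proof -
    have "\<exists>n\<le>2. \<exists>xs. walk V E xs \<and> hd xs = u \<and> last xs = v \<and> length xs = Suc n"
    proof (cases "u = v")
      case True
      have "walk V E [u]" using uv unfolding walk_def by simp
      then show ?thesis using True by (intro exI[of _ 0] conjI exI[of _ "[u]"]) auto
    next
      case ne: False
      show ?thesis
      proof (cases "u = p 0 \<or> v = p 0")
        case True
        then have "{u, v} \<in> E" using uv ne adj V by auto
        then have "walk V E [u, v]" using uv unfolding walk_def by simp
        then show ?thesis by (intro exI[of _ 1] conjI exI[of _ "[u, v]"]) auto
      next
        case False
        then have "u \<in> L 0" "v \<in> L 0" using uv V by auto
        then have "walk V E [u, p 0, v]"
          using uv adj V unfolding walk_def by (auto simp: less_Suc_eq nth_Cons')
        then show ?thesis by (intro exI[of _ 2] conjI exI[of _ "[u, p 0, v]"]) auto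
      qed
    qed
    then obtain n where "n \<le> 2" and n: "\<exists>xs. walk V E xs \<and> hd xs = u \<and> last xs = v \<and> length xs = Suc n"
      by blast
    then have "graph_dist V E u v \<le> n" unfolding graph_dist_def by (intro Least_le)
    then show ?thesis using \<open>n \<le> 2\<close> by simp
  qed
  let ?D = "{graph_dist V E u v | u v. u \<in> V \<and> v \<in> V}"
  \<comment> \<open>The bound also gives finiteness, without which \<open>Max\<close> would be
    unspecified.\<close>
  have sub: "?D \<subseteq> {..2}" using le by auto
  moreover have "?D \<noteq> {}" using V by blast
  ultimately have "Max ?D \<in> {..2}" using Max_in[of ?D] finite_subset by blast
  then show ?thesis unfolding diameter_def by simp
qed

theorem theorem5:
  fixes V :: "'a set" and E :: "'a set set" and first :: player
  assumes "caterpillar V E" and "diameter V E \<ge> 3"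
  shows "\<exists>\<sigma>. winning_strategy V E first Bob \<sigma>"
proof (rule bob_wins_imp_strategy)
  obtain ks where "ks \<noteq> []" "is_cat ks V E" using assms(1) unfolding caterpillar_def by blast
  then obtain p L where "spine V E p (length ks) L" "1 \<le> length ks"
    using is_cat_imp_spine[of ks V E] by (auto simp: Suc_le_eq)
  then obtain p s L where "spine V E p s L" "s = 1 \<or> proper_spine V E p s L"
    using spine_imp_proper_or_star by blast
  then interpret proper_spine V E p s L
    using diameter_star assms(2) by fastforce
  show "bob_wins V E first []"
    using alice_first bob_first by (cases first) auto
qed

end
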